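(* Let $T\ge 2$ and $N\ge1$ be integers, $\epsilon\in(0,1)$, $\bm\mu\in\mathbb R^N$, $\bm\Sigma=[\sigma_{ij}]\in\mathbb S^N$ with $\bm\Sigma\succ\bm0$, and let $\rho_0,\dots,\rho_{T-1}\in\mathbb R$ satisfy $\rho_0=1$, $\rho_t=\rho_{T-t}$ for $t=1,\dots,T-1$, and $\mathrm{circ}(\rho_0,\dots,\rho_{T-1})\succ\bm0$. Let $\mathcal P$ be the set of all probability distributions $\mathbb P$ of random vectors $(\tilde{\bm r}_1,\dots,\tilde{\bm r}_T)\in\mathbb R^{NT}$ (each $\tilde{\bm r}_t=(\tilde r_{t,1},\dots,\tilde r_{t,N})\in\mathbb R^N$) with finite second moments such that $\mathbb E_{\mathbb P}(\tilde r_{t,i})=\mu_i$ for all $i,t$ and $\mathrm{Cov}_{\mathbb P}(\tilde r_{s,i},\tilde r_{t,j})=\rho_{(t-s)\bmod T}\,\sigma_{ij}$ for all $i,j\in\{1,\dots,N\}$, $s,t\in\{1,\dots,T\}$. For $\bm w\in\mathbb R^N_+$ define the worst-case growth rate $$\mathcal G_\epsilon(\bm w)=\sup\Big\{\gamma\in\mathbb R:\ \mathbb P\Big(\tfrac1T\textstyle\sum_{t=1}^T\big(\bm w^\intercal\tilde{\bm r}_t-\tfrac12(\bm w^\intercal\tilde{\bm r}_t)^2\big)\ge\gamma\Big)\ge 1-\epsilon\ \ \forall\,\mathbb P\in\mathcal P\Big\}.$$ Let $\bar\rho=\frac{1}{T-1}\sum_{t=1}^{T-1}\rho_t$. If $\bm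 w\in\mathbb R^N_+$ satisfies $$1-\bm w^\intercal\bm\mu>\sqrt{\frac{(1+(T-1)\bar\rho)\epsilon}{(1-\epsilon)T}}\,\|\bm\Sigma^{1/2}\bm w\|,$$ then $$\mathcal G_\epsilon(\bm w)=\frac12\left(1-\left(1-\bm w^\intercal\bm\mu+\sqrt{\frac{(1-\epsilon)(1+(T-1)\bar\rho)}{\epsilon T}}\,\|\bm\Sigma^{1/2}\bm w\|\right)^2-\frac{T-1-(T-1)\bar\rho}{\epsilon T}\,\bm w^\intercal\bm\Sigma\bm w\right).$$
   Context: $\mathbb S^N$ is the set of real symmetric $N\times N$ matrices; $\bm\Sigma^{1/2}$ is the principal (positive semidefinite) square root; $\|\cdot\|$ is the Euclidean norm. $\mathrm{circ}(c_0,\dots,c_{T-1})$ denotes the $T\times T$ circulant matrix with $(s,t)$ entry $c_{(t-s)\bmod T}$. The vector $\bm w$ represents a fixed-mix portfolio re-balanced to the same weights in each of the $T$ periods, and $\tilde{\bm r}_t$ the asset returns in period $t$. *)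

theory Defs
  imports "HOL-Probability.Probability"
begin

text \<open>Vectors in R^N are functions nat => real (only indices < N matter); N x N matrices are
  functions nat => nat => real (only indices < N matter).  Indices are 0-based.\<close>

definition sym_mat :: "nat \<Rightarrow> (nat \<Rightarrow> nat \<Rightarrow> real) \<Rightarrow> bool" where
  "sym_mat n A \<longleftrightarrow> (\<forall>i<n. \<forall>j<n. A i j = A j i)"

definition quad_form :: "nat \<Rightarrow> (nat \<Rightarrow> nat \<Rightarrow> real) \<Rightarrow> (nat \<Rightarrow> real) \<Rightarrow> real" where
  "quad_form n A x = (\<Sum>i<n. \<Sum>j<n. x i * A i j * x j)"

definition pos_def :: "nat \<Rightarrow> (nat \<Rightarrow> nat \<Rightarrow> real) \<Rightarrow> bool" where
  "pos_def n A \<longleftrightarrow> sym_mat n A \<and> (\<forall>x. (\<exists>i<n. x i \<noteq> 0) \<longrightarrow> quad_form n A x > 0)"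

definition pos_semidef :: "nat \<Rightarrow> (nat \<Rightarrow> nat \<Rightarrow> real) \<Rightarrow> bool" where
  "pos_semidef n A \<longleftrightarrow> sym_mat n A \<and> (\<forall>x. quad_form n A x \<ge> 0)"

text \<open>Principal square root: the unique symmetric PSD matrix S with S*S = A
  (entries outside the index range set to 0 for uniqueness).\<close>
definition psd_sqrt :: "nat \<Rightarrow> (nat \<Rightarrow> nat \<Rightarrow> real) \<Rightarrow> (nat \<Rightarrow> nat \<Rightarrow> real)" where
  "psd_sqrt n A = (THE S. (\<forall>i j. (n \<le> i \<or> n \<le> j) \<longrightarrow> S i j = 0) \<and> pos_semidef n S \<and>
       (\<forall>i<n. \<forall>j<n. (\<Sum>k<n. S i k * S k j) = A i j))"

definition mat_vec :: "nat \<Rightarrow> (nat \<Rightarrow> nat \<Rightarrow> real) \<Rightarrow> (nat \<Rightarrow> real) \<Rightarrow> (nat \<Rightarrow> real)" where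
  "mat_vec n A x = (\<lambda>i. \<Sum>j<n. A i j * x j)"

definition vnorm :: "nat \<Rightarrow> (nat \<Rightarrow> real) \<Rightarrow> real" where
  "vnorm n x = sqrt (\<Sum>i<n. (x i)\<^sup>2)"

definition dotp :: "nat \<Rightarrow> (nat \<Rightarrow> real) \<Rightarrow> (nat \<Rightarrow> real) \<Rightarrow> real" where
  "dotp n x y = (\<Sum>i<n. x i * y i)"

definition circ :: "nat \<Rightarrow> (nat \<Rightarrow> real) \<Rightarrow> (nat \<Rightarrow> nat \<Rightarrow> real)" where
  "circ T c = (\<lambda>s t. c (nat ((int t - int s) mod int T)))"

text \<open>Sample space R^{NT}: points x with x (t,i) = return of asset i in period t
  (t < T, i < N, 0-based).\<close>
definition returns_space :: "nat \<Rightarrow> nat \<Rightarrow> (nat \<times> nat \<Rightarrow> real) measure" where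
  "returns_space T N = PiM ({..<T} \<times> {..<N}) (\<lambda>_. borel)"

definition ambiguity_set :: "nat \<Rightarrow> nat \<Rightarrow> (nat \<Rightarrow> real) \<Rightarrow> (nat \<Rightarrow> nat \<Rightarrow> real)
      \<Rightarrow> (nat \<Rightarrow> real) \<Rightarrow> (nat \<times> nat \<Rightarrow> real) measure set" where
  "ambiguity_set T N \<mu> \<Sigma> \<rho> = {P. prob_space P \<and> sets P = sets (returns_space T N) \<and>
     (\<forall>t<T. \<forall>i<N. integrable P (\<lambda>x. (x (t,i))\<^sup>2)) \<and>
     (\<forall>t<T. \<forall>i<N. (\<integral>x. x (t,i) \<partial>P) = \<mu> i) \<and>
     (\<forall>s<T. \<forall>t<T. \<forall>i<N. \<forall>j<N.
        (\<integral>x. (x (s,i) - \<mu> i) * (x (t,j) - \<mu> j) \<partial>P) = circ T \<rho> s t * \<Sigma> i j)}"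

definition growth_sum :: "nat \<Rightarrow> nat \<Rightarrow> (nat \<Rightarrow> real) \<Rightarrow> (nat \<times> nat \<Rightarrow> real) \<Rightarrow> real" where
  "growth_sum T N w x = (1 / real T) * (\<Sum>t<T. let p = (\<Sum>i<N. w i * x (t,i)) in p - p\<^sup>2 / 2)"

definition worst_case_growth :: "nat \<Rightarrow> nat \<Rightarrow> real \<Rightarrow> (nat \<Rightarrow> real) \<Rightarrow> (nat \<Rightarrow> nat \<Rightarrow> real)
      \<Rightarrow> (nat \<Rightarrow> real) \<Rightarrow> (nat \<Rightarrow> real) \<Rightarrow> real" where
  "worst_case_growth T N \<epsilon> \<mu> \<Sigma> \<rho> w = Sup {\<gamma>::real. \<forall>P \<in> ambiguity_set T N \<mu> \<Sigma> \<rho>.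
      measure P {x \<in> space P. growth_sum T N w x \<ge> \<gamma>} \<ge> 1 - \<epsilon>}"

end

theory Submission
  imports Defs
begin

text \<open>
  Put \<open>q\<^sub>t = 1 - p\<^sub>t\<close> for the portfolio returns \<open>p\<^sub>t\<close>.  Growth below \<open>\<gamma>\<close> means that the time average of
  \<open>q\<^sub>t\<^sup>2\<close> exceeds \<open>1 - 2 \<gamma>\<close>, and this average is the squared mean of the \<open>q\<^sub>t\<close> plus their variance over
  time.  The ambiguity set fixes the first two moments of the mean (variance \<open>v\<close>, through the row sum
  \<open>\<Sum>\<^sub>t \<rho>\<^sub>t\<close>, the eigenvalue of the circulant matrix at the all-ones vector) and the expected variance
  over time \<open>b\<close>.  Markov's inequality for a suitable quadratic function bounds the tail from above.
  Conversely, let the mean of the \<open>q\<^sub>t\<close> take two values, with probabilities \<open>\<epsilon>\<close> and \<open>1 - \<epsilon>\<close>, and let the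
  variance over time be \<open>b / \<epsilon>\<close> surely on the first event and 0 on the second.  Constancy is possible
  because the columns of a symmetric square root of the centered circulant matrix all have the same
  norm: the squared norms are its diagonal entries.  The bound is attained only with equality, so
  the construction is used with probabilities slightly above \<open>\<epsilon>\<close> and a limit is taken.
\<close>

section \<open>Quadratic forms and principal square roots\<close>

lemma dotp_commute: "dotp n x y = dotp n y x"
  by (simp add: dotp_def mult.commute)

lemma dotp_add_right: "dotp n x (\<lambda>i. y i + z i) = dotp n x y + dotp n x z"
  by (simp add: dotp_def algebra_simps sum.distrib)

lemma dotp_scale_right: "dotp n x (\<lambda>i. c * y i) = c * dotp n x y"
  by (simp add: dotp_def sum_distrib_left mult_ac)

lemma dotp_self_nonneg: "dotp n x x \<ge> 0"
  by (simp add: dotp_def sum_nonneg)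

lemma dotp_self_eq_0: "dotp n x x = 0 \<Longrightarrow> i < n \<Longrightarrow> x i = 0"
  by (auto simp: dotp_def sum_nonneg_eq_0_iff)

lemma dotp_cong: "(\<And>i. i < n \<Longrightarrow> x i = x' i) \<Longrightarrow> (\<And>i. i < n \<Longrightarrow> y i = y' i) \<Longrightarrow> dotp n x y = dotp n x' y'"
  by (simp add: dotp_def)

lemma abs_dotp_le: "\<bar>dotp n x y\<bar> \<le> (dotp n x x + dotp n y y) / 2"
proof -
  have "\<bar>x i * y i\<bar> \<le> (x i * x i + y i * y i) / 2" for i
  proof -
    have "(x i - y i)\<^sup>2 \<ge> 0" "(x i + y i)\<^sup>2 \<ge> 0" by auto
    then show ?thesis unfolding power2_eq_square abs_le_iff by (auto simp: algebra_simps)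
  qed
  then have *: "(\<Sum>i<n. \<bar>x i * y i\<bar>) \<le> (\<Sum>i<n. (x i * x i + y i * y i) / 2)" by (intro sum_mono)
  show ?thesis unfolding dotp_def
    using order.trans[OF sum_abs *]
    by (simp add: sum.distrib flip: sum_divide_distrib)
qed

lemma quad_form_dotp: "quad_form n A x = dotp n x (mat_vec n A x)"
  by (simp add: quad_form_def dotp_def mat_vec_def sum_distrib_left mult_ac)

lemma mat_vec_add_scale: "mat_vec n A (\<lambda>i. x i + c * y i) = (\<lambda>i. mat_vec n A x i + c * mat_vec n A y i)"
  by (simp add: mat_vec_def algebra_simps sum.distrib sum_distrib_left)

lemma dotp_mat_vec_sym:
  assumes "sym_mat n A"
  shows "dotp n x (mat_vec n A y) = dotp n (mat_vec n A x) y"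
proof -
  have "dotp n x (mat_vec n A y) = (\<Sum>i<n. \<Sum>j<n. x i * A i j * y j)"
    by (simp add: dotp_def mat_vec_def sum_distrib_left mult_ac)
  also have "\<dots> = (\<Sum>j<n. \<Sum>i<n. x i * A i j * y j)" by (rule sum.swap)
  also have "\<dots> = (\<Sum>j<n. \<Sum>i<n. x i * A j i * y j)"
    using assms by (intro sum.cong) (auto simp: sym_mat_def)
  also have "\<dots> = dotp n (mat_vec n A x) y"
    unfolding dotp_def mat_vec_def sum_distrib_right by (simp add: mult_ac)
  finally show ?thesis .
qed

lemma quad_form_add_scale:
  assumes "sym_mat n A"
  shows "quad_form n A (\<lambda>i. x i + c * y i) =
    quad_form n A x + 2 * c * dotp n x (mat_vec n A y) + c\<^sup>2 * quad_form n A y"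
proof -
  have "dotp n (\<lambda>i. x i + c * y i) z = dotp n x z + c * dotp n y z" for z
    by (subst (1 2 3) dotp_commute) (simp add: dotp_add_right dotp_scale_right)
  then show ?thesis
    using dotp_mat_vec_sym[OF assms, of y x] dotp_commute[of n "mat_vec n A y" x]
    by (simp add: quad_form_dotp mat_vec_add_scale dotp_add_right dotp_scale_right
        power2_eq_square algebra_simps)
qed

lemma pos_def_imp_semidef:
  assumes "pos_def n A" shows "pos_semidef n A"
  unfolding pos_semidef_def
proof (intro conjI allI)
  show "sym_mat n A" using assms by (simp add: pos_def_def)
  fix x
  show "0 \<le> quad_form n A x"
  proof (cases "\<exists>i<n. x i \<noteq> 0")
    case True
    then show ?thesis using assms by (auto simp: pos_def_def less_imp_le)
  next
    case False
    then show ?thesis by (simp add: quad_form_def)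
  qed
qed

text \<open>The form attains its minimum 0 at \<open>x\<close>, so its derivative in the direction
  \<open>y = A x\<close> vanishes; that derivative is twice the squared norm of
  \<open>y\<close>.\<close>

lemma pos_semidef_kernel:
  assumes "pos_semidef n A" "quad_form n A x = 0" "i < n"
  shows "mat_vec n A x i = 0"
proof -
  define y where "y = mat_vec n A x"
  define a where "a = dotp n y y"
  define b where "b = quad_form n A y"
  have S: "sym_mat n A" and ge: "\<And>z. quad_form n A z \<ge> 0" using assms by (auto simp: pos_semidef_def)
  have xy: "dotp n x (mat_vec n A y) = a"
    using dotp_mat_vec_sym[OF S, of x y] by (simp add: a_def y_def)
  have *: "2 * c * a + c\<^sup>2 * b \<ge> 0" for c
    using ge[of "\<lambda>i. x i + c * y i"] quad_form_add_scale[OF S, of x c y] assms(2) xy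
    by (simp add: b_def)
  have "b \<ge> 0" using ge by (simp add: b_def)
  have "a = 0"
  proof (rule ccontr)
    assume "a \<noteq> 0"
    then have a: "a > 0" using dotp_self_nonneg[of n y] by (simp add: a_def)
    \<comment> \<open>Negative, and small enough for the linear term to win: the expression becomes
      \<open>c * (a - c)\<close>. The \<open>+ 1\<close> covers \<open>b = 0\<close>.\<close>
    define c where "c = - a / (b + 1)"
    have "c * (b + 1) = - a" using \<open>b \<ge> 0\<close> by (simp add: c_def)
    then have cb: "c * b = - a - c" by (simp add: algebra_simps)
    have "2 * c * a + c\<^sup>2 * b = c * (2 * a + c * b)"
      by (simp add: power2_eq_square algebra_simps)
    then have "2 * c * a + c\<^sup>2 * b = c * (a - c)"
      unfolding cb by simp
    moreover have "c < 0" using a \<open>b \<ge> 0\<close> by (simp add: c_def divide_neg_pos)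
    ultimately show False using *[of c] a by (smt (verit) mult_neg_pos)
  qed
  then show ?thesis using dotp_self_eq_0 assms(3) by (metis a_def y_def)
qed

section \<open>Powers of a symmetric contraction\<close>

primrec mpow :: "nat \<Rightarrow> (nat \<Rightarrow> nat \<Rightarrow> real) \<Rightarrow> nat \<Rightarrow> nat \<Rightarrow> nat \<Rightarrow> real" where
  "mpow n X 0 = (\<lambda>i j. if i = j then 1 else 0)"
| "mpow n X (Suc k) = (\<lambda>i j. \<Sum>l<n. X i l * mpow n X k l j)"

lemma mpow_add:
  assumes "i < n"
  shows "mpow n X (a + b) i j = (\<Sum>l<n. mpow n X a i l * mpow n X b l j)"
  using assms
proof (induction a arbitrary: i)
  case 0
  then show ?case
    by (simp add: if_distrib[of "\<lambda>z. z * _"] cong: if_cong)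
next
  case (Suc a)
  have "mpow n X (Suc a + b) i j = (\<Sum>m<n. \<Sum>l<n. X i m * mpow n X a m l * mpow n X b l j)"
    using Suc.IH by (simp add: sum_distrib_left mult_ac)
  also have "\<dots> = (\<Sum>l<n. \<Sum>m<n. X i m * mpow n X a m l * mpow n X b l j)" by (rule sum.swap)
  finally show ?case by (simp add: sum_distrib_right)
qed

lemma mpow_1: "j < n \<Longrightarrow> mpow n X (Suc 0) i j = X i j"
  by (simp add: if_distrib cong: if_cong)

text \<open>Transposing the recursion puts the extra factor \<open>X\<close> on the right, and
  \<open>mpow_add\<close> moves it back to the left.\<close>

lemma mpow_sym:
  assumes "sym_mat n X" "i < n" "j < n"
  shows "mpow n X k i j = mpow n X k j i"
  using assms(2,3)
proof (induction k arbitrary: i j)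
  case 0
  then show ?case by auto
next
  case (Suc k)
  have "mpow n X (Suc k) i j = (\<Sum>l<n. mpow n X k j l * X l i)"
    using Suc assms(1) by (auto simp: sym_mat_def mult.commute intro!: sum.cong)
  also have "\<dots> = (\<Sum>l<n. mpow n X k j l * mpow n X (Suc 0) l i)"
    using Suc.prems by (simp only: mpow_1)
  also have "\<dots> = mpow n X (k + Suc 0) j i" using Suc.prems by (simp only: mpow_add)
  finally show ?case by simp
qed

lemma mat_vec_mpow_Suc: "mat_vec n (mpow n X (Suc k)) y = mat_vec n X (mat_vec n (mpow n X k) y)"
proof
  fix i
  have "mat_vec n (mpow n X (Suc k)) y i = (\<Sum>j<n. \<Sum>l<n. X i l * mpow n X k l j * y j)"
    by (simp add: mat_vec_def sum_distrib_right)
  also have "\<dots> = (\<Sum>l<n. \<Sum>j<n. X i l * mpow n X k l j * y j)" by (rule sum.swap)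
  finally show "mat_vec n (mpow n X (Suc k)) y i = mat_vec n X (mat_vec n (mpow n X k) y) i"
    by (simp add: mat_vec_def sum_distrib_left mult_ac)
qed

text \<open>An argument without eigenvalues: with \<open>z = X y\<close>, nonnegativity of the form
  at \<open>y - z\<close> bounds the squared norm of \<open>z\<close> by the inner product of
  \<open>y\<close> and \<open>z\<close>, which is the form at \<open>y\<close>.\<close>

lemma mat_vec_contraction:
  assumes "pos_semidef n X" and le: "\<And>x. quad_form n X x \<le> dotp n x x"
  shows "dotp n (mat_vec n X y) (mat_vec n X y) \<le> dotp n y y"
proof -
  define z where "z = mat_vec n X y"
  have S: "sym_mat n X" using assms by (simp add: pos_semidef_def)
  have "0 \<le> quad_form n X (\<lambda>i. y i + (- 1) * z i)" using assms(1) by (auto simp: pos_semidef_def)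
  also have "\<dots> = dotp n y z - 2 * dotp n z z + quad_form n X z"
    unfolding quad_form_add_scale[OF S] dotp_mat_vec_sym[OF S, of y z]
    by (simp add: z_def quad_form_dotp)
  finally have "dotp n z z \<le> dotp n y z" using le[of z] by simp
  also have "\<dots> \<le> dotp n y y" using le[of y] by (simp add: quad_form_dotp z_def)
  finally show ?thesis by (simp add: z_def)
qed

lemma mpow_contraction:
  assumes "pos_semidef n X" "\<And>x. quad_form n X x \<le> dotp n x x"
  shows "dotp n (mat_vec n (mpow n X k) y) (mat_vec n (mpow n X k) y) \<le> dotp n y y"
proof (induction k)
  case 0
  have "mat_vec n (mpow n X 0) y i = y i" if "i < n" for i
    using that by (simp add: mat_vec_def if_distrib[of "\<lambda>z. z * _"] cong: if_cong)
  then show ?case by (simp cong: dotp_cong)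
next
  case (Suc k)
  then show ?case
    unfolding mat_vec_mpow_Suc using mat_vec_contraction[OF assms] order.trans by blast
qed

text \<open>The bound is uniform in \<open>k\<close>: at unit vectors it makes power series in
  \<open>X\<close> converge entrywise, and with \<open>x = y\<close> it controls their quadratic
  forms.\<close>

lemma abs_dotp_mpow_le:
  assumes "pos_semidef n X" "\<And>x. quad_form n X x \<le> dotp n x x"
  shows "\<bar>dotp n x (mat_vec n (mpow n X k) y)\<bar> \<le> (dotp n x x + dotp n y y) / 2"
  by (rule order.trans[OF abs_dotp_le]) (simp add: mpow_contraction[OF assms])

lemma abs_mpow_le_1:
  assumes "pos_semidef n X" "\<And>x. quad_form n X x \<le> dotp n x x" "i < n" "j < n"
  shows "\<bar>mpow n X k i j\<bar> \<le> 1"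
proof -
  let ?e = "\<lambda>i l::nat. if l = i then 1 else 0 :: real"
  have "mat_vec n (mpow n X k) (?e j) = (\<lambda>i. mpow n X k i j)"
    using assms(4) by (simp add: mat_vec_def if_distrib cong: if_cong)
  moreover have "dotp n (?e i) y = y i" if "i < n" for i y
    using that by (simp add: dotp_def if_distrib[of "\<lambda>z. z * _"] cong: if_cong)
  ultimately show ?thesis
    using abs_dotp_mpow_le[OF assms(1,2), of "?e i" k "?e j"] assms(3,4) by simp
qed

text \<open>The coefficients of \<open>1 - sqrt (1 - x) = (\<Sum>n. sqrt_coeff n * x ^ n)\<close>; the recursion is
  \<open>2 * y = x + y\<^sup>2\<close> read coefficientwise.\<close>

fun sqrt_coeff :: "nat \<Rightarrow> real" where
  "sqrt_coeff n = ((if n = 1 then 1 else 0) + (\<Sum>i\<in>{1..<n}. sqrt_coeff i * sqrt_coeff (n - i))) / 2"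

declare sqrt_coeff.simps [simp del]

lemma sqrt_coeff_0 [simp]: "sqrt_coeff 0 = 0"
  by (subst sqrt_coeff.simps) simp

lemma sqrt_coeff_nonneg: "sqrt_coeff n \<ge> 0"
proof (induction n rule: less_induct)
  case (less n)
  then show ?case
    by (subst sqrt_coeff.simps) (auto intro!: add_nonneg_nonneg sum_nonneg mult_nonneg_nonneg)
qed

lemma sqrt_coeff_convolution:
  "(\<Sum>i\<le>n. sqrt_coeff i * sqrt_coeff (n - i)) = 2 * sqrt_coeff n - (if n = 1 then 1 else 0)"
proof -
  have "(\<Sum>i\<le>n. sqrt_coeff i * sqrt_coeff (n - i)) = (\<Sum>i\<in>{1..<n}. sqrt_coeff i * sqrt_coeff (n - i))"
  proof (rule sum.mono_neutral_right)
    show "\<forall>i\<in>{..n} - {1..<n}. sqrt_coeff i * sqrt_coeff (n - i) = 0"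
    proof
      fix i assume "i \<in> {..n} - {1..<n}"
      then have "i = 0 \<or> i = n" by auto
      then show "sqrt_coeff i * sqrt_coeff (n - i) = 0" by auto
    qed
  qed auto
  then show ?thesis using sqrt_coeff.simps[of n] by simp
qed

text \<open>With \<open>s N\<close> for the partial sum, the recursion yields
  \<open>2 * s (N + 1) \<le> 1 + (s N)\<^sup>2\<close>, so the bound 1 is inherited.\<close>

lemma sum_sqrt_coeff_le_1: "(\<Sum>n\<le>N. sqrt_coeff n) \<le> 1"
proof (induction N)
  case 0
  then show ?case by simp
next
  case (Suc N)
  let ?c = sqrt_coeff
  have "2 * (\<Sum>n\<le>Suc N. ?c n) = (\<Sum>n\<le>Suc N. (if n = 1 then 1 else 0) + (\<Sum>i\<le>n. ?c i * ?c (n - i)))"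
    using sqrt_coeff_convolution by (simp add: sum_distrib_left del: sum.atMost_Suc)
  also have "\<dots> = 1 + (\<Sum>n\<le>Suc N. \<Sum>i\<le>n. ?c i * ?c (n - i))"
    by (simp add: sum.distrib del: sum.atMost_Suc)
  also have "(\<Sum>n\<le>Suc N. \<Sum>i\<le>n. ?c i * ?c (n - i)) = (\<Sum>(i,j)\<in>{(i,j). i + j \<le> Suc N}. ?c i * ?c j)"
    by (rule sum.triangle_reindex_eq[symmetric])
  \<comment> \<open>As \<open>sqrt_coeff 0 = 0\<close>, only positive indices count. Each of them is
    then at most \<open>N\<close>, and the triangle fits into a square.\<close>
  also have "\<dots> = (\<Sum>(i,j)\<in>{(i,j). i + j \<le> Suc N \<and> i \<noteq> 0 \<and> j \<noteq> 0}. ?c i * ?c j)"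
  proof (rule sum.mono_neutral_right)
    have "{(i,j). i + j \<le> Suc N} \<subseteq> {..Suc N} \<times> {..Suc N}" by auto
    then show "finite {(i,j). i + j \<le> Suc N}" by (rule finite_subset) auto
  qed (auto, (metis gr0I sqrt_coeff_0)+)
  also have "\<dots> \<le> (\<Sum>(i,j)\<in>{..N} \<times> {..N}. ?c i * ?c j)"
    by (rule sum_mono2) (auto intro!: mult_nonneg_nonneg sqrt_coeff_nonneg)
  also have "\<dots> = (\<Sum>i\<le>N. ?c i)\<^sup>2"
    by (simp add: power2_eq_square sum_product sum.cartesian_product)
  also have "\<dots> \<le> 1"
    using Suc by (simp add: power_le_one sum_nonneg sqrt_coeff_nonneg)
  finally show ?case by simp
qed

lemma sum_lessThan_sqrt_coeff_le_1: "(\<Sum>i<n. sqrt_coeff i) \<le> 1"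
proof -
  have "(\<Sum>i<n. sqrt_coeff i) \<le> (\<Sum>i\<le>n. sqrt_coeff i)"
    by (rule sum_mono2) (auto simp: sqrt_coeff_nonneg)
  then show ?thesis using sum_sqrt_coeff_le_1[of n] by simp
qed

lemma summable_sqrt_coeff: "summable sqrt_coeff"
  using sum_lessThan_sqrt_coeff_le_1 sqrt_coeff_nonneg by (intro summableI_nonneg_bounded)

lemma suminf_sqrt_coeff_le_1: "suminf sqrt_coeff \<le> 1"
  using summable_sqrt_coeff sum_lessThan_sqrt_coeff_le_1 by (rule suminf_le_const)

text \<open>\<open>S = I - Y\<close>, where \<open>Y\<close> is the power series with coefficients
  \<open>sqrt_coeff\<close> evaluated at \<open>X\<close>. Squaring the series gives
  \<open>Y * Y = 2 * Y - X\<close>, that is \<open>S * S = I - X\<close>.\<close>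

lemma ex_sqrt_of_one_minus:
  assumes X: "pos_semidef n X" and le: "\<And>x. quad_form n X x \<le> dotp n x x"
  shows "\<exists>S. pos_semidef n S \<and>
    (\<forall>i<n. \<forall>j<n. (\<Sum>k<n. S i k * S k j) = (if i = j then 1 else 0) - X i j)"
proof -
  let ?c = sqrt_coeff
  define M where "M = mpow n X"
  define Y where "Y i j = (\<Sum>k. ?c k * M k i j)" for i j
  define S where "S i j = (if i = j then 1 else 0) - Y i j" for i j
  have sX: "sym_mat n X" using X by (simp add: pos_semidef_def)
  have nsm: "summable (\<lambda>k. norm (?c k * M k i j))" if "i < n" "j < n" for i j
  proof (rule summable_comparison_test[OF _ summable_sqrt_coeff], intro exI allI impI)
    fix k
    have "\<bar>M k i j\<bar> \<le> 1" using abs_mpow_le_1[OF X le that] by (simp add: M_def)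
    then show "norm (norm (?c k * M k i j)) \<le> ?c k"
      using sqrt_coeff_nonneg[of k] by (simp add: abs_mult mult_left_le)
  qed
  then have Y_sums: "(\<lambda>k. ?c k * M k i j) sums Y i j" if "i < n" "j < n" for i j
    unfolding Y_def using that by (intro summable_sums summable_norm_cancel[OF nsm])
  have Y_sym: "Y i j = Y j i" if "i < n" "j < n" for i j
    using mpow_sym[OF sX that] by (simp add: Y_def M_def)
  have YY: "(\<Sum>l<n. Y i l * Y l j) = 2 * Y i j - X i j" if "i < n" "j < n" for i j
  proof -
    \<comment> \<open>Cauchy product of the two series in each summand; \<open>nsm\<close> supplies
      absolute convergence.\<close>
    have "(\<lambda>k. \<Sum>l<n. \<Sum>a\<le>k. ?c a * M a i l * (?c (k - a) * M (k - a) l j)) sums (\<Sum>l<n. Y i l * Y l j)"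
      unfolding Y_def using that by (intro sums_sum Cauchy_product_sums nsm) auto
    also have "(\<lambda>k. \<Sum>l<n. \<Sum>a\<le>k. ?c a * M a i l * (?c (k - a) * M (k - a) l j))
      = (\<lambda>k. 2 * (?c k * M k i j) - (if k = 1 then M k i j else 0))"
    proof
      fix k
      have "(\<Sum>l<n. \<Sum>a\<le>k. ?c a * M a i l * (?c (k - a) * M (k - a) l j))
        = (\<Sum>a\<le>k. \<Sum>l<n. ?c a * M a i l * (?c (k - a) * M (k - a) l j))" by (rule sum.swap)
      also have "\<dots> = (\<Sum>a\<le>k. ?c a * ?c (k - a) * M k i j)"
      proof (rule sum.cong)
        fix a assume "a \<in> {..k}"
        then have "M k i j = (\<Sum>l<n. M a i l * M (k - a) l j)"
          using mpow_add[OF \<open>i < n\<close>, of X a "k - a" j] by (simp add: M_def)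
        then show "(\<Sum>l<n. ?c a * M a i l * (?c (k - a) * M (k - a) l j)) = ?c a * ?c (k - a) * M k i j"
          by (simp add: sum_distrib_left mult_ac)
      qed simp
      also have "\<dots> = (\<Sum>a\<le>k. ?c a * ?c (k - a)) * M k i j" by (simp add: sum_distrib_right)
      also have "\<dots> = 2 * (?c k * M k i j) - (if k = 1 then M k i j else 0)"
        unfolding sqrt_coeff_convolution by (simp add: algebra_simps)
      finally show "(\<Sum>l<n. \<Sum>a\<le>k. ?c a * M a i l * (?c (k - a) * M (k - a) l j))
        = 2 * (?c k * M k i j) - (if k = 1 then M k i j else 0)" .
    qed
    finally have 1: "(\<lambda>k. 2 * (?c k * M k i j) - (if k = 1 then M k i j else 0)) sums (\<Sum>l<n. Y i l * Y l j)" .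
    have "(\<lambda>k. 2 * (?c k * M k i j) - (if k = 1 then M k i j else 0)) sums (2 * Y i j - M 1 i j)"
      using that by (intro sums_diff sums_mult Y_sums sums_single) auto
    moreover have "M 1 i j = X i j" using mpow_1[OF that(2), of X i] by (simp add: M_def)
    ultimately show ?thesis using sums_unique2[OF 1] by simp
  qed
  have SS: "(\<Sum>k<n. S i k * S k j) = (if i = j then 1 else 0) - X i j" if "i < n" "j < n" for i j
  proof -
    have "(\<Sum>k<n. S i k * S k j) = (\<Sum>k<n. (if i = k then if k = j then 1 else 0 else 0)
       - (if i = k then Y k j else 0) - (if k = j then Y i k else 0) + Y i k * Y k j)"
      by (rule sum.cong) (auto simp: S_def algebra_simps)
    also have "\<dots> = (if i = j then 1 else 0) - Y i j - Y i j + (\<Sum>k<n. Y i k * Y k j)"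
      using that by (simp add: sum.distrib sum_subtractf)
    finally show ?thesis using YY[OF that] by simp
  qed
  have "pos_semidef n S"
    unfolding pos_semidef_def
  proof (intro conjI allI)
    show "sym_mat n S" using Y_sym by (auto simp: sym_mat_def S_def)
    fix x
    have "quad_form n S x = (\<Sum>i<n. \<Sum>j<n. (if i = j then x i * x j else 0) - x i * Y i j * x j)"
      unfolding quad_form_def by (intro sum.cong) (auto simp: S_def algebra_simps)
    also have "\<dots> = dotp n x x - quad_form n Y x"
      by (simp add: sum_subtractf quad_form_def dotp_def)
    finally have eq: "quad_form n S x = dotp n x x - quad_form n Y x" .
    have "(\<lambda>k. \<Sum>i<n. \<Sum>j<n. x i * (?c k * M k i j) * x j) sums quad_form n Y x"
      unfolding quad_form_def by (intro sums_sum sums_mult sums_mult2 Y_sums) auto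
    also have "(\<lambda>k. \<Sum>i<n. \<Sum>j<n. x i * (?c k * M k i j) * x j) = (\<lambda>k. ?c k * quad_form n (M k) x)"
      by (simp add: quad_form_def sum_distrib_left mult_ac)
    finally have *: "(\<lambda>k. ?c k * quad_form n (M k) x) sums quad_form n Y x" .
    \<comment> \<open>\<open>Y\<close> is dominated by the coefficient sum times the identity. That
      this sum is at most 1 makes \<open>I - Y\<close> positive semidefinite.\<close>
    have "quad_form n Y x \<le> suminf ?c * dotp n x x"
    proof (rule sums_le[OF _ * sums_mult2[OF summable_sums[OF summable_sqrt_coeff]]])
      fix k
      have "quad_form n (M k) x \<le> dotp n x x"
        using abs_dotp_mpow_le[OF X le, of x k x] by (simp add: quad_form_dotp M_def)
      then show "?c k * quad_form n (M k) x \<le> ?c k * dotp n x x"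
        using sqrt_coeff_nonneg by (intro mult_left_mono)
    qed
    also have "\<dots> \<le> 1 * dotp n x x"
      by (intro mult_right_mono suminf_sqrt_coeff_le_1 dotp_self_nonneg)
    finally show "0 \<le> quad_form n S x" using eq by simp
  qed
  then show ?thesis using SS by blast
qed

section \<open>Existence and uniqueness of the principal square root\<close>

lemma quad_form_le_scaled_dotp: "\<exists>c>0. \<forall>x. quad_form n A x \<le> c * dotp n x x"
proof (intro exI conjI allI)
  let ?c = "(\<Sum>i<n. \<Sum>j<n. \<bar>A i j\<bar>) + 1"
  show "0 < ?c" by (intro add_nonneg_pos sum_nonneg) auto
  fix x
  have "x i * A i j * x j \<le> \<bar>A i j\<bar> * dotp n x x" if "i < n" "j < n" for i j
  proof -
    have "(x k)\<^sup>2 \<le> dotp n x x" if "k < n" for k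
      using member_le_sum[of k "{..<n}" "\<lambda>i. (x i)\<^sup>2"] that by (simp add: dotp_def power2_eq_square)
    then have "\<bar>x k\<bar> \<le> sqrt (dotp n x x)" if "k < n" for k
      using that by (simp add: real_le_rsqrt)
    then have "\<bar>x i\<bar> * \<bar>x j\<bar> \<le> sqrt (dotp n x x) * sqrt (dotp n x x)"
      using that by (intro mult_mono) (auto simp: dotp_self_nonneg)
    then have "\<bar>x i\<bar> * \<bar>x j\<bar> \<le> dotp n x x" by (simp add: dotp_self_nonneg)
    then have "\<bar>A i j\<bar> * (\<bar>x i\<bar> * \<bar>x j\<bar>) \<le> \<bar>A i j\<bar> * dotp n x x" by (rule mult_left_mono) simp
    moreover have "x i * A i j * x j \<le> \<bar>A i j\<bar> * (\<bar>x i\<bar> * \<bar>x j\<bar>)"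
      by (rule order.trans[OF abs_ge_self]) (simp add: abs_mult mult_ac)
    ultimately show ?thesis by linarith
  qed
  then have "quad_form n A x \<le> (\<Sum>i<n. \<Sum>j<n. \<bar>A i j\<bar> * dotp n x x)"
    unfolding quad_form_def by (intro sum_mono) auto
  also have "\<dots> \<le> ?c * dotp n x x"
    using dotp_self_nonneg[of n x] unfolding distrib_right sum_distrib_right by simp
  finally show "quad_form n A x \<le> ?c * dotp n x x" .
qed

text \<open>For large \<open>c\<close> the matrix \<open>X = I - A / c\<close> lies between 0 and
  the identity; a root of \<open>I - X = A / c\<close> is then scaled by
  \<open>sqrt c\<close>.\<close>

lemma ex_psd_sqrt:
  assumes A: "pos_semidef n A"
  shows "\<exists>S. pos_semidef n S \<and> (\<forall>i<n. \<forall>j<n. (\<Sum>k<n. S i k * S k j) = A i j)"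
proof -
  obtain c where c: "c > 0" and le: "\<And>x. quad_form n A x \<le> c * dotp n x x"
    using quad_form_le_scaled_dotp by blast
  define X where "X i j = (if i = j then 1 else 0) - A i j / c" for i j
  have quad: "quad_form n X x = dotp n x x - quad_form n A x / c" for x
  proof -
    have "quad_form n X x = (\<Sum>i<n. \<Sum>j<n. (if i = j then x i * x j else 0) - x i * A i j * x j / c)"
      unfolding quad_form_def by (intro sum.cong) (auto simp: X_def algebra_simps)
    then show ?thesis
      by (simp add: sum_subtractf quad_form_def dotp_def flip: sum_divide_distrib)
  qed
  have "pos_semidef n X"
    using A le c by (auto simp: pos_semidef_def quad sym_mat_def X_def field_simps)
  moreover have "quad_form n X x \<le> dotp n x x" for x
    using A c by (simp add: quad pos_semidef_def)
  ultimately obtain S where S: "pos_semidef n S"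
    and SS: "\<And>i j. i < n \<Longrightarrow> j < n \<Longrightarrow> (\<Sum>k<n. S i k * S k j) = (if i = j then 1 else 0) - X i j"
    using ex_sqrt_of_one_minus[of n X] by blast
  define R where "R i j = sqrt c * S i j" for i j
  have "quad_form n R x = sqrt c * quad_form n S x" for x
    by (simp add: quad_form_def R_def sum_distrib_left mult_ac)
  then have "pos_semidef n R"
    using S c by (simp add: pos_semidef_def sym_mat_def R_def)
  moreover have "(\<Sum>k<n. R i k * R k j) = A i j" if "i < n" "j < n" for i j
  proof -
    have "(\<Sum>k<n. R i k * R k j) = (\<Sum>k<n. (sqrt c * sqrt c) * (S i k * S k j))"
      unfolding R_def by (intro sum.cong) (simp_all add: mult_ac)
    also have "\<dots> = c * (A i j / c)"
      unfolding sum_distrib_left[symmetric] using SS[OF that] c by (simp add: X_def)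
    finally show ?thesis using c by simp
  qed
  ultimately show ?thesis by blast
qed

text \<open>With \<open>D = S - R\<close> one has \<open>D S + R D = S\<^sup>2 - R\<^sup>2 = 0\<close>, so \<open>D (S + R) D\<close> has trace 0;
  being positive semidefinite, \<open>S\<close> and \<open>R\<close> then both annihilate the columns of \<open>D\<close>.\<close>

lemma psd_sqrt_unique:
  assumes S: "pos_semidef n S" and R: "pos_semidef n R"
    and eq: "\<And>i j. i < n \<Longrightarrow> j < n \<Longrightarrow> (\<Sum>k<n. S i k * S k j) = (\<Sum>k<n. R i k * R k j)"
    and ij: "i < n" "j < n"
  shows "S i j = R i j"
proof -
  define D where "D i j = S i j - R i j" for i j
  have sS: "sym_mat n S" and sR: "sym_mat n R" using S R by (auto simp: pos_semidef_def)
  have D_sym: "D i j = D j i" if "i < n" "j < n" for i j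
    using sS sR that by (simp add: D_def sym_mat_def)
  have DS: "(\<Sum>k<n. D i k * S k j) = - (\<Sum>k<n. R i k * D k j)" if "i < n" "j < n" for i j
    using eq[OF that] by (simp add: D_def algebra_simps sum_subtractf)
  let ?d = "\<lambda>j i. D i j"
  have 1: "quad_form n S (?d j) = (\<Sum>i<n. (\<Sum>k<n. D j k * S k i) * D i j)" if "j < n" for j
  proof -
    have "quad_form n S (?d j) = (\<Sum>k<n. \<Sum>i<n. D j k * S k i * D i j)"
      unfolding quad_form_def using that by (intro sum.cong) (auto simp: D_sym)
    also have "\<dots> = (\<Sum>i<n. \<Sum>k<n. D j k * S k i * D i j)" by (rule sum.swap)
    finally show ?thesis by (simp add: sum_distrib_right)
  qed
  have 2: "quad_form n R (?d i) = (\<Sum>j<n. D j i * (\<Sum>k<n. R j k * D k i))" for i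
    by (simp add: quad_form_def sum_distrib_left mult_ac)
  have "(\<Sum>j<n. quad_form n S (?d j)) = (\<Sum>j<n. \<Sum>i<n. (\<Sum>k<n. D j k * S k i) * D i j)"
    using 1 by simp
  also have "\<dots> = (\<Sum>j<n. \<Sum>i<n. - (D i j * (\<Sum>k<n. R j k * D k i)))"
    using DS by (intro sum.cong) auto
  also have "\<dots> = (\<Sum>i<n. \<Sum>j<n. - (D i j * (\<Sum>k<n. R j k * D k i)))" by (rule sum.swap)
  also have "\<dots> = - (\<Sum>i<n. quad_form n R (?d i))"
    unfolding 2 sum_negf by (intro arg_cong[of _ _ uminus] sum.cong) (auto simp: D_sym)
  finally have sum0: "(\<Sum>j<n. quad_form n S (?d j)) + (\<Sum>j<n. quad_form n R (?d j)) = 0" by simp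
  have nn: "quad_form n S x \<ge> 0" "quad_form n R x \<ge> 0" for x
    using S R by (auto simp: pos_semidef_def)
  have "(\<Sum>j<n. quad_form n S (?d j)) = 0" "(\<Sum>j<n. quad_form n R (?d j)) = 0"
    using sum0 sum_nonneg[of "{..<n}" "\<lambda>j. quad_form n S (?d j)"]
      sum_nonneg[of "{..<n}" "\<lambda>j. quad_form n R (?d j)"] nn by auto
  then have "quad_form n S (?d j) = 0" "quad_form n R (?d j) = 0"
    using nn ij by (auto simp: sum_nonneg_eq_0_iff)
  then have "mat_vec n S (?d j) i = 0" "mat_vec n R (?d j) i = 0" if "i < n" for i
    using pos_semidef_kernel S R that by blast+
  \<comment> \<open>\<open>S\<close> and \<open>R\<close> both annihilate column \<open>j\<close> of
    \<open>D\<close>, hence so does their difference \<open>D\<close>. By symmetry of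
    \<open>D\<close> the column has norm 0.\<close>
  then have "(\<Sum>k<n. D i k * D k j) = 0" if "i < n" for i
    using that by (simp add: mat_vec_def D_def left_diff_distrib sum_subtractf)
  then have "(\<Sum>k<n. D j k * D k j) = 0" using ij by blast
  then have "dotp n (?d j) (?d j) = 0"
    unfolding dotp_def using D_sym ij by simp
  then have "D i j = 0" using dotp_self_eq_0[of n "?d j" i] ij by blast
  then show ?thesis by (simp add: D_def)
qed

text \<open>The definite description is justified by truncating any root to zero outside the index
  range and applying \<open>psd_sqrt_unique\<close> inside it.\<close>

lemma psd_sqrt_props:
  assumes A: "pos_semidef n A"
  shows "pos_semidef n (psd_sqrt n A)"
    and "i < n \<Longrightarrow> j < n \<Longrightarrow> (\<Sum>k<n. psd_sqrt n A i k * psd_sqrt n A k j) = A i j"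
proof -
  let ?P = "\<lambda>S. (\<forall>i j. (n \<le> i \<or> n \<le> j) \<longrightarrow> S i j = 0) \<and> pos_semidef n S \<and>
       (\<forall>i<n. \<forall>j<n. (\<Sum>k<n. S i k * S k j) = A i j)"
  obtain S where S: "pos_semidef n S" "\<forall>i<n. \<forall>j<n. (\<Sum>k<n. S i k * S k j) = A i j"
    using ex_psd_sqrt[OF A] by blast
  define R where "R i j = (if i < n \<and> j < n then S i j else 0)" for i j
  have "quad_form n R x = quad_form n S x" for x
    by (simp add: quad_form_def R_def)
  then have "?P R" using S by (auto simp: R_def pos_semidef_def sym_mat_def)
  moreover have "R' = R" if "?P R'" for R'
  proof (intro ext)
    fix i j
    show "R' i j = R i j"
    proof (cases "i < n \<and> j < n")
      case True
      then show ?thesis using psd_sqrt_unique[of n R' R i j] that \<open>?P R\<close> by simp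
    next
      case False
      then show ?thesis using that \<open>?P R\<close> by (metis not_le)
    qed
  qed
  ultimately have "?P (psd_sqrt n A)" unfolding psd_sqrt_def by (rule theI)
  then show "pos_semidef n (psd_sqrt n A)"
    "i < n \<Longrightarrow> j < n \<Longrightarrow> (\<Sum>k<n. psd_sqrt n A i k * psd_sqrt n A k j) = A i j" by auto
qed

text \<open>Besides computing norms, this shows that a vector on which the form of \<open>A\<close>
  vanishes is annihilated by the root \<open>S\<close>.\<close>

lemma dotp_mat_vec_self:
  assumes "sym_mat n S" "\<And>i j. i < n \<Longrightarrow> j < n \<Longrightarrow> (\<Sum>k<n. S i k * S k j) = A i j"
  shows "dotp n (mat_vec n S x) (mat_vec n S x) = quad_form n A x"
proof -
  have "mat_vec n S (mat_vec n S x) i = mat_vec n A x i" if "i < n" for i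
  proof -
    have "mat_vec n S (mat_vec n S x) i = (\<Sum>k<n. \<Sum>j<n. S i k * S k j * x j)"
      by (simp add: mat_vec_def sum_distrib_left mult_ac)
    also have "\<dots> = (\<Sum>j<n. \<Sum>k<n. S i k * S k j * x j)" by (rule sum.swap)
    also have "\<dots> = (\<Sum>j<n. (\<Sum>k<n. S i k * S k j) * x j)" by (simp add: sum_distrib_right)
    finally show ?thesis using assms(2) that by (simp add: mat_vec_def)
  qed
  then show ?thesis
    using dotp_mat_vec_sym[OF assms(1), of x "mat_vec n S x"]
    by (simp add: quad_form_dotp cong: dotp_cong)
qed

lemma vnorm_psd_sqrt:
  assumes "pos_semidef n A"
  shows "vnorm n (mat_vec n (psd_sqrt n A) x) = sqrt (quad_form n A x)"
  using dotp_mat_vec_self[of n "psd_sqrt n A" A x] psd_sqrt_props[OF assms]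
  by (simp add: vnorm_def dotp_def power2_eq_square pos_semidef_def)

text \<open>The deflated form at \<open>x\<close> is the form of \<open>A\<close> at the component
  of \<open>x\<close> that is \<open>A\<close>-orthogonal to \<open>w\<close>. It serves both to
  center the circulant matrix over time and to split off the asset risk invisible to the
  portfolio.\<close>

lemma pos_semidef_deflate:
  assumes A: "pos_semidef n A" and w: "quad_form n A w > 0"
  shows "pos_semidef n (\<lambda>i j. A i j - mat_vec n A w i * mat_vec n A w j / quad_form n A w)"
    (is "pos_semidef n ?B")
    and "quad_form n (\<lambda>i j. A i j - mat_vec n A w i * mat_vec n A w j / quad_form n A w) w = 0"
proof -
  let ?q = "quad_form n A w"
  have sA: "sym_mat n A" using A by (simp add: pos_semidef_def)
  have quad: "quad_form n ?B x = quad_form n A x - (dotp n x (mat_vec n A w))\<^sup>2 / ?q" for x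
  proof -
    have "quad_form n ?B x = quad_form n A x -
        (\<Sum>i<n. \<Sum>j<n. (x i * mat_vec n A w i) * (x j * mat_vec n A w j)) / ?q"
      by (simp add: quad_form_def algebra_simps sum_subtractf sum_divide_distrib)
    then show ?thesis by (simp add: dotp_def power2_eq_square sum_product)
  qed
  show "pos_semidef n ?B"
    unfolding pos_semidef_def
  proof (intro conjI allI)
    show "sym_mat n ?B" using sA by (simp add: sym_mat_def mult.commute)
    fix x
    define a where "a = dotp n x (mat_vec n A w)"
    \<comment> \<open>The coefficient minimises the form on the line through \<open>x\<close> in the
      direction \<open>w\<close>.\<close>
    have "0 \<le> quad_form n A (\<lambda>i. x i + (- a / ?q) * w i)" using A by (simp add: pos_semidef_def)
    also have "\<dots> = quad_form n A x - a\<^sup>2 / ?q"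
      unfolding quad_form_add_scale[OF sA] a_def[symmetric] using w
      by (simp add: power2_eq_square field_simps)
    finally show "0 \<le> quad_form n ?B x" by (simp add: quad a_def)
  qed
  show "quad_form n ?B w = 0"
    using w by (simp add: quad quad_form_dotp[symmetric] power2_eq_square)
qed

section \<open>Moments of the portfolio returns\<close>

lemma circ_row_sum:
  assumes "s < T"
  shows "(\<Sum>t<T. circ T \<rho> s t) = (\<Sum>k<T. \<rho> k)"
proof (rule sum.reindex_bij_witness)
  let ?j = "\<lambda>t. nat ((int t - int s) mod int T)" and ?i = "\<lambda>k. (k + s) mod T"
  fix t assume t: "t \<in> {..<T}"
  have "(int t - int s) mod int T \<ge> 0" "(int t - int s) mod int T < int T"
    using assms by (auto intro: pos_mod_sign pos_mod_bound)
  then show "?j t \<in> {..<T}" by (simp add: nat_less_iff)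
  have "int (?i (?j t)) = ((int t - int s) mod int T + int s) mod int T"
    using \<open>(int t - int s) mod int T \<ge> 0\<close> by (simp add: zmod_int)
  also have "\<dots> = int t" using t by (simp add: mod_add_left_eq)
  finally show "?i (?j t) = t" by simp
  show "\<rho> (?j t) = circ T \<rho> s t" by (simp add: circ_def)
next
  let ?j = "\<lambda>t. nat ((int t - int s) mod int T)" and ?i = "\<lambda>k. (k + s) mod T"
  fix k assume k: "k \<in> {..<T}"
  show "?i k \<in> {..<T}" using assms by auto
  have "(int (?i k) - int s) mod int T = int k"
    using k by (simp add: zmod_int mod_diff_left_eq)
  then show "?j (?i k) = k" by simp
qed

lemma mat_vec_circ_ones: "s < T \<Longrightarrow> mat_vec T (circ T \<rho>) (\<lambda>_. 1) s = (\<Sum>k<T. \<rho> k)"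
  by (simp add: mat_vec_def circ_row_sum)

lemma quad_form_circ_ones: "quad_form T (circ T \<rho>) (\<lambda>_. 1) = real T * (\<Sum>k<T. \<rho> k)"
  by (simp add: quad_form_def circ_row_sum)

lemma sum_circ_weights_pos:
  assumes "T > 0" "pos_def T (circ T \<rho>)"
  shows "(\<Sum>k<T. \<rho> k) > 0"
proof -
  have "quad_form T (circ T \<rho>) (\<lambda>_. 1) > 0"
    using assms by (auto simp: pos_def_def)
  then show ?thesis using assms(1) by (simp add: quad_form_circ_ones zero_less_mult_iff)
qed

text \<open>The all-ones vector is an eigenvector whose eigenvalue is the sum \<open>l\<close> of
  the weights, so deflation along it subtracts the constant
  \<open>l * l / (T * l) = l / T\<close>.\<close>

lemma pos_semidef_circ_centered:
  assumes "T > 0" "pos_def T (circ T \<rho>)"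
  shows "\<exists>B. pos_semidef T B \<and> quad_form T B (\<lambda>_. 1) = 0 \<and>
    (\<forall>s<T. \<forall>t<T. B s t = circ T \<rho> s t - (\<Sum>k<T. \<rho> k) / T)"
proof -
  let ?C = "circ T \<rho>" and ?l = "\<Sum>k<T. \<rho> k"
  have l: "?l > 0" by (rule sum_circ_weights_pos[OF assms])
  then have q: "quad_form T ?C (\<lambda>_. 1) > 0" using assms(1) by (simp add: quad_form_circ_ones)
  show ?thesis
    using pos_semidef_deflate[OF pos_def_imp_semidef[OF assms(2)] q] l assms(1)
    by (intro exI[of _ "\<lambda>i j. ?C i j - mat_vec T ?C (\<lambda>_. 1) i * mat_vec T ?C (\<lambda>_. 1) j / quad_form T ?C (\<lambda>_. 1)"])
       (auto simp: mat_vec_circ_ones quad_form_circ_ones)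
qed

text \<open>A diagonal entry of the centered matrix is nonnegative. This later makes the expected
  variance over time nonnegative.\<close>

lemma sum_circ_weights_le:
  assumes "T > 0" "pos_def T (circ T \<rho>)" "\<rho> 0 = 1"
  shows "(\<Sum>k<T. \<rho> k) \<le> T"
proof -
  obtain B where B: "pos_semidef T B"
    "\<And>s t. s < T \<Longrightarrow> t < T \<Longrightarrow> B s t = circ T \<rho> s t - (\<Sum>k<T. \<rho> k) / T"
    using pos_semidef_circ_centered[OF assms(1,2)] by blast
  have "quad_form T B (\<lambda>i. if i = 0 then 1 else 0) = B 0 0"
    using assms(1) by (simp add: quad_form_def if_distrib[of "\<lambda>z. z * _"] if_distrib[of "\<lambda>z. _ * z"] cong: if_cong)
  then have "0 \<le> B 0 0" using B(1) by (metis pos_semidef_def)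
  then show ?thesis using B(2)[of 0 0] assms by (simp add: circ_def field_simps)
qed

section \<open>Centered portfolio returns and their moments\<close>

definition pf_dev :: "nat \<Rightarrow> (nat \<Rightarrow> real) \<Rightarrow> (nat \<Rightarrow> real) \<Rightarrow> nat \<Rightarrow> (nat \<times> nat \<Rightarrow> real) \<Rightarrow> real" where
  "pf_dev N \<mu> w t x = (\<Sum>i<N. w i * (x (t,i) - \<mu> i))"

text \<open>Completing the square, \<open>p - p\<^sup>2 / 2 = (1 - (1 - p)\<^sup>2) / 2\<close>, turns growth events into
  deviation events for the mean of the squares of \<open>1 - p\<close>.\<close>

definition mean_sq :: "nat \<Rightarrow> nat \<Rightarrow> (nat \<Rightarrow> real) \<Rightarrow> (nat \<Rightarrow> real) \<Rightarrow> (nat \<times> nat \<Rightarrow> real) \<Rightarrow> real" where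
  "mean_sq T N \<mu> w x = (\<Sum>t<T. (1 - dotp N w \<mu> - pf_dev N \<mu> w t x)\<^sup>2) / T"

lemma growth_sum_eq_mean_sq:
  assumes "T > 0"
  shows "growth_sum T N w x = (1 - mean_sq T N \<mu> w x) / 2"
proof -
  define p where "p t = (\<Sum>i<N. w i * x (t,i))" for t
  have *: "1 - dotp N w \<mu> - pf_dev N \<mu> w t x = 1 - p t" for t
    by (simp add: pf_dev_def dotp_def p_def algebra_simps sum_subtractf)
  have "(1 - mean_sq T N \<mu> w x) / 2 = (1 - (\<Sum>t<T. (1 - p t)\<^sup>2) / T) / 2"
    unfolding mean_sq_def * ..
  also have "\<dots> = (real T - (\<Sum>t<T. (1 - p t)\<^sup>2)) / (2 * T)" using assms by (simp add: field_simps)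
  also have "real T - (\<Sum>t<T. (1 - p t)\<^sup>2) = (\<Sum>t<T. 2 * (p t - (p t)\<^sup>2 / 2))"
    unfolding power2_eq_square by (simp add: algebra_simps sum.distrib sum_subtractf)
  finally show ?thesis
    unfolding growth_sum_def Let_def p_def[symmetric] sum_distrib_left[symmetric] by simp
qed

lemma borel_measurable_pf_dev [measurable]:
  assumes "t < T"
  shows "pf_dev N \<mu> w t \<in> borel_measurable (returns_space T N)"
proof -
  have [measurable]: "(\<lambda>x. x (t,i)) \<in> borel_measurable (returns_space T N)" if "i < N" for i
    unfolding returns_space_def using that assms by (intro measurable_component_singleton) auto
  show ?thesis unfolding pf_dev_def[abs_def] by (auto intro!: borel_measurable_sum)
qed

lemma borel_measurable_mean_sq [measurable]:
  "mean_sq T N \<mu> w \<in> borel_measurable (returns_space T N)"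
  unfolding mean_sq_def[abs_def] by (auto intro!: borel_measurable_sum borel_measurable_divide)

lemma abs_mult_le_sum_squares: "\<bar>a * b\<bar> \<le> a\<^sup>2 + b\<^sup>2" for a b :: real
proof -
  have "2 * (\<bar>a\<bar> * \<bar>b\<bar>) \<le> a\<^sup>2 + b\<^sup>2" using sum_squares_bound[of "\<bar>a\<bar>" "\<bar>b\<bar>"] by simp
  moreover have "0 \<le> \<bar>a\<bar> * \<bar>b\<bar>" by simp
  ultimately show ?thesis unfolding abs_mult by linarith
qed

context
  fixes T N :: nat and \<mu> w :: "nat \<Rightarrow> real" and \<Sigma> :: "nat \<Rightarrow> nat \<Rightarrow> real" and \<rho> :: "nat \<Rightarrow> real" and P
  assumes P: "P \<in> ambiguity_set T N \<mu> \<Sigma> \<rho>"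
begin

interpretation prob_space P using P by (simp add: ambiguity_set_def)

lemma borel_measurable_ambiguity [measurable_cong]: "sets P = sets (returns_space T N)"
  using P by (simp add: ambiguity_set_def)

text \<open>The ambiguity set provides integrable squares only. Products are dominated by sums of
  two squares, and first powers are integrable because \<open>P\<close> is a probability
  measure.\<close>

lemma integrable_coord_prod:
  assumes "s < T" "t < T" "i < N" "j < N"
  shows "integrable P (\<lambda>x. (x (s,i) - \<mu> i) * (x (t,j) - \<mu> j))"
    and "integrable P (\<lambda>x. x (t,j))"
proof -
  have coord: "(\<lambda>x. x (t,i)) \<in> borel_measurable P" if "t < T" "i < N" for t i
    unfolding measurable_cong_sets[OF borel_measurable_ambiguity refl] returns_space_def using that by (intro measurable_component_singleton) auto
  note [measurable] = coord[OF assms(1,3)] coord[OF assms(2,4)]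
  have sq: "integrable P (\<lambda>x. (x (t,i))\<^sup>2)" if "t < T" "i < N" for t i
    using P that by (simp add: ambiguity_set_def)
  have 1: "integrable P (\<lambda>x. x (t,i))" if "t < T" "i < N" for t i
    by (rule square_integrable_imp_integrable[OF coord[OF that] sq[OF that]])
  have 2: "integrable P (\<lambda>x. x (s,i) * x (t,j))"
    by (rule Bochner_Integration.integrable_bound[OF Bochner_Integration.integrable_add[OF sq[OF assms(1,3)] sq[OF assms(2,4)]]])
       (auto intro!: AE_I2 abs_mult_le_sum_squares)
  show "integrable P (\<lambda>x. x (t,j))" by (rule 1[OF assms(2,4)])
  show "integrable P (\<lambda>x. (x (s,i) - \<mu> i) * (x (t,j) - \<mu> j))"
    unfolding left_diff_distrib right_diff_distrib using 1 2 assms by auto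
qed

lemma pf_dev_mean:
  assumes "t < T"
  shows "integrable P (pf_dev N \<mu> w t)" and "(\<integral>x. pf_dev N \<mu> w t x \<partial>P) = 0"
proof -
  have mean: "(\<integral>x. x (t,i) \<partial>P) = \<mu> i" if "i < N" for i
    using P assms that by (simp add: ambiguity_set_def)
  have int: "integrable P (\<lambda>x. w i * (x (t,i) - \<mu> i))" if "i \<in> {..<N}" for i
    using integrable_coord_prod(2)[OF assms assms, of i i] that by auto
  show "integrable P (pf_dev N \<mu> w t)"
    unfolding pf_dev_def[abs_def] by (rule Bochner_Integration.integrable_sum[OF int])
  have "(\<integral>x. pf_dev N \<mu> w t x \<partial>P) = (\<Sum>i<N. \<integral>x. w i * (x (t,i) - \<mu> i) \<partial>P)"
    unfolding pf_dev_def by (rule Bochner_Integration.integral_sum[OF int])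
  also have "\<dots> = 0"
    using integrable_coord_prod(2)[OF assms assms] mean by (intro sum.neutral) (auto simp: prob_space)
  finally show "(\<integral>x. pf_dev N \<mu> w t x \<partial>P) = 0" .
qed

lemma pf_dev_cov:
  assumes "s < T" "t < T"
  shows "integrable P (\<lambda>x. pf_dev N \<mu> w s x * pf_dev N \<mu> w t x)"
    and "(\<integral>x. pf_dev N \<mu> w s x * pf_dev N \<mu> w t x \<partial>P) = circ T \<rho> s t * quad_form N \<Sigma> w"
proof -
  let ?f = "\<lambda>i j x. w i * w j * ((x (s,i) - \<mu> i) * (x (t,j) - \<mu> j))"
  have cov: "(\<integral>x. ?f i j x \<partial>P) = circ T \<rho> s t * (w i * \<Sigma> i j * w j)" if "i < N" "j < N" for i j
    using P assms that by (simp add: ambiguity_set_def)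
  have int: "integrable P (?f i j)" if "i \<in> {..<N}" "j \<in> {..<N}" for i j
    using integrable_coord_prod(1)[OF assms] that by auto
  have int': "integrable P (\<lambda>x. \<Sum>j<N. ?f i j x)" if "i \<in> {..<N}" for i
    using int that by (intro Bochner_Integration.integrable_sum)
  have eq: "pf_dev N \<mu> w s x * pf_dev N \<mu> w t x = (\<Sum>i<N. \<Sum>j<N. ?f i j x)" for x
    unfolding pf_dev_def sum_product by (simp add: mult_ac)
  show "integrable P (\<lambda>x. pf_dev N \<mu> w s x * pf_dev N \<mu> w t x)"
    unfolding eq by (rule Bochner_Integration.integrable_sum[OF int'])
  have "(\<integral>x. pf_dev N \<mu> w s x * pf_dev N \<mu> w t x \<partial>P) = (\<Sum>i<N. \<integral>x. (\<Sum>j<N. ?f i j x) \<partial>P)"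
    unfolding eq by (rule Bochner_Integration.integral_sum[OF int'])
  also have "\<dots> = (\<Sum>i<N. \<Sum>j<N. \<integral>x. ?f i j x \<partial>P)"
    using int by (intro sum.cong refl Bochner_Integration.integral_sum) auto
  also have "\<dots> = (\<Sum>i<N. \<Sum>j<N. circ T \<rho> s t * (w i * \<Sigma> i j * w j))"
    using cov by (intro sum.cong refl) auto
  finally show "(\<integral>x. pf_dev N \<mu> w s x * pf_dev N \<mu> w t x \<partial>P) = circ T \<rho> s t * quad_form N \<Sigma> w"
    by (simp add: quad_form_def sum_distrib_left)
qed

text \<open>The variance of the time average is the average of all covariances between periods, and
  every row of the circulant matrix has the same sum.\<close>

lemma mean_pf_dev_moments:
  assumes "T > 0"
  defines "D \<equiv> \<lambda>x. (\<Sum>t<T. pf_dev N \<mu> w t x) / T"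
  shows "integrable P D" and "(\<integral>x. D x \<partial>P) = 0"
    and "integrable P (\<lambda>x. (D x)\<^sup>2)"
    and "(\<integral>x. (D x)\<^sup>2 \<partial>P) = quad_form N \<Sigma> w * (\<Sum>k<T. \<rho> k) / T"
proof -
  let ?d = "pf_dev N \<mu> w"
  show "integrable P D"
    unfolding D_def by (intro integrable_divide_zero Bochner_Integration.integrable_sum pf_dev_mean) auto
  have "(\<integral>x. (\<Sum>t<T. ?d t x) \<partial>P) = (\<Sum>t<T. \<integral>x. ?d t x \<partial>P)"
    by (rule Bochner_Integration.integral_sum) (auto intro: pf_dev_mean)
  then show "(\<integral>x. D x \<partial>P) = 0" unfolding D_def using pf_dev_mean by simp
  have eq: "(D x)\<^sup>2 = (\<Sum>s<T. \<Sum>t<T. ?d s x * ?d t x) / (real T)\<^sup>2" for x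
    by (simp add: D_def power2_eq_square sum_product)
  have int: "integrable P (\<lambda>x. \<Sum>t<T. ?d s x * ?d t x)" if "s \<in> {..<T}" for s
    using that by (intro Bochner_Integration.integrable_sum pf_dev_cov) auto
  show "integrable P (\<lambda>x. (D x)\<^sup>2)"
    unfolding eq by (intro integrable_divide_zero Bochner_Integration.integrable_sum int) auto
  have "(\<integral>x. (D x)\<^sup>2 \<partial>P) = (\<integral>x. (\<Sum>s<T. \<Sum>t<T. ?d s x * ?d t x) \<partial>P) / (real T)\<^sup>2"
    unfolding eq by simp
  also have "(\<integral>x. (\<Sum>s<T. \<Sum>t<T. ?d s x * ?d t x) \<partial>P) = (\<Sum>s<T. \<integral>x. (\<Sum>t<T. ?d s x * ?d t x) \<partial>P)"
    by (rule Bochner_Integration.integral_sum[OF int])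
  also have "\<dots> = (\<Sum>s<T. \<Sum>t<T. \<integral>x. ?d s x * ?d t x \<partial>P)"
    by (intro sum.cong refl Bochner_Integration.integral_sum pf_dev_cov) auto
  also have "\<dots> = (\<Sum>s<T. (\<Sum>t<T. circ T \<rho> s t) * quad_form N \<Sigma> w)"
    using pf_dev_cov(2) by (simp add: sum_distrib_right)
  also have "\<dots> = T * (\<Sum>k<T. \<rho> k) * quad_form N \<Sigma> w"
    by (simp add: circ_row_sum)
  finally show "(\<integral>x. (D x)\<^sup>2 \<partial>P) = quad_form N \<Sigma> w * (\<Sum>k<T. \<rho> k) / T"
    using assms(1) by (simp add: power2_eq_square)
qed

lemma mean_sq_expectation:
  assumes "T > 0" "\<rho> 0 = 1"
  shows "integrable P (mean_sq T N \<mu> w)"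
    and "(\<integral>x. mean_sq T N \<mu> w x \<partial>P) = (1 - dotp N w \<mu>)\<^sup>2 + quad_form N \<Sigma> w"
proof -
  let ?a = "1 - dotp N w \<mu>" and ?d = "pf_dev N \<mu> w"
  let ?f = "\<lambda>t x. ?a\<^sup>2 - 2 * ?a * ?d t x + ?d t x * ?d t x"
  have eq: "mean_sq T N \<mu> w = (\<lambda>x. (\<Sum>t<T. ?f t x) / T)"
    unfolding mean_sq_def by (simp add: power2_eq_square algebra_simps)
  have d: "circ T \<rho> t t = 1" for t using assms(2) by (simp add: circ_def)
  have int: "integrable P (?f t)" if "t \<in> {..<T}" for t
    using that by (intro Bochner_Integration.integrable_add Bochner_Integration.integrable_diff
        Bochner_Integration.integrable_mult_right pf_dev_mean pf_dev_cov) auto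
  have exp: "(\<integral>x. ?f t x \<partial>P) = ?a\<^sup>2 + quad_form N \<Sigma> w" if "t < T" for t
  proof -
    have "(\<integral>x. ?f t x \<partial>P) = (\<integral>x. ?a\<^sup>2 - 2 * ?a * ?d t x \<partial>P) + (\<integral>x. ?d t x * ?d t x \<partial>P)"
      using that pf_dev_mean(1)[of t] by (intro Bochner_Integration.integral_add pf_dev_cov) auto
    also have "(\<integral>x. ?a\<^sup>2 - 2 * ?a * ?d t x \<partial>P) = ?a\<^sup>2"
      using that pf_dev_mean[of t] by (simp add: prob_space)
    finally show ?thesis using pf_dev_cov(2)[OF that that] d by simp
  qed
  show "integrable P (mean_sq T N \<mu> w)"
    unfolding eq by (intro integrable_divide_zero Bochner_Integration.integrable_sum int)
  have "(\<integral>x. mean_sq T N \<mu> w x \<partial>P) = (\<integral>x. (\<Sum>t<T. ?f t x) \<partial>P) / T" unfolding eq by simp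
  also have "(\<integral>x. (\<Sum>t<T. ?f t x) \<partial>P) = (\<Sum>t<T. \<integral>x. ?f t x \<partial>P)"
    by (rule Bochner_Integration.integral_sum[OF int])
  also have "\<dots> = (\<Sum>t<T. ?a\<^sup>2 + quad_form N \<Sigma> w)"
    using exp by (intro sum.cong refl) auto
  finally show "(\<integral>x. mean_sq T N \<mu> w x \<partial>P) = ?a\<^sup>2 + quad_form N \<Sigma> w" using assms(1) by simp
qed

end

section \<open>The tail bound\<close>

text \<open>Cauchy-Schwarz; in other words, the variance over time is nonnegative.\<close>

lemma sum_average_squared_le:
  assumes "T > 0"
  shows "((\<Sum>t<T. f t) / real T)\<^sup>2 \<le> (\<Sum>t<T. (f t)\<^sup>2) / real T"
proof -
  have "(\<Sum>t<T. f t)\<^sup>2 \<le> (\<Sum>t<T. (f t)\<^sup>2) * real T"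
    using sum_squared_le_sum_of_squares[of f "{..<T}"] by simp
  then show ?thesis using assms by (simp add: power2_eq_square field_simps)
qed

text \<open>The weight \<open>1 - y / x\<close> is the one for which the terms in \<open>m\<close>
  leave a multiple of \<open>(m - x)\<^sup>2\<close>. Hence on the tail event the function is at
  least its value at mean \<open>x\<close> and variance \<open>k\<close>.\<close>

lemma mean_sq_decomposition_ge:
  fixes x y m q k :: real
  assumes "0 < x" "0 < y" "y < x" "q \<ge> x\<^sup>2 + k"
  shows "(m - y)\<^sup>2 + (1 - y / x) * (q - m\<^sup>2) \<ge> (x - y)\<^sup>2 + (1 - y / x) * k"
proof -
  have "(m - y)\<^sup>2 - (1 - y / x) * m\<^sup>2 + (1 - y / x) * x\<^sup>2 - (x - y)\<^sup>2 = (y / x) * (m - x)\<^sup>2"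
    using assms(1) by (simp add: power2_eq_square field_simps)
  moreover have "0 \<le> (y / x) * (m - x)\<^sup>2" using assms by simp
  moreover have "(1 - y / x) * (x\<^sup>2 + k) \<le> (1 - y / x) * q" using assms by (intro mult_left_mono) auto
  ultimately show ?thesis by (simp add: algebra_simps)
qed

text \<open>Markov's inequality for the quadratic function \<open>(m - y)\<^sup>2 + (1 - y / x) * s\<close>, with \<open>m\<close> the mean and
  \<open>s\<close> the variance over time of \<open>1 - p\<^sub>t\<close>.  It is the optimal dual certificate: \<open>x\<close> and \<open>y\<close> are
  the values of \<open>m\<close> under the extremal two-point distribution.\<close>

lemma mean_sq_tail_le:
  fixes \<epsilon> :: real and w :: "nat \<Rightarrow> real"
  assumes P: "P \<in> ambiguity_set T N \<mu> \<Sigma> \<rho>" and T: "T > 0" and \<rho>0: "\<rho> 0 = 1"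
    and \<epsilon>: "0 < \<epsilon>" "\<epsilon> < 1"
  defines "a \<equiv> 1 - dotp N w \<mu>" and "v \<equiv> quad_form N \<Sigma> w * (\<Sum>k<T. \<rho> k) / T"
  defines "b \<equiv> quad_form N \<Sigma> w - v"
  assumes v: "v > 0" and b: "b \<ge> 0" and y_pos: "a > sqrt (\<epsilon> / (1 - \<epsilon>) * v)"
  shows "measure P {z \<in> space P. mean_sq T N \<mu> w z > (a + sqrt ((1 - \<epsilon>) / \<epsilon> * v))\<^sup>2 + b / \<epsilon>} \<le> \<epsilon>"
proof -
  interpret prob_space P using P by (simp add: ambiguity_set_def)
  define \<alpha> where "\<alpha> = sqrt ((1 - \<epsilon>) / \<epsilon> * v)"
  define \<beta> where "\<beta> = sqrt (\<epsilon> / (1 - \<epsilon>) * v)"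
  \<comment> \<open>Taking \<open>x\<close> with probability \<open>\<epsilon>\<close> and
    \<open>y\<close> with probability \<open>1 - \<epsilon>\<close> gives mean \<open>a\<close> and
    variance \<open>v\<close>; \<open>y_pos\<close> says \<open>y > 0\<close>.\<close>
  define x where "x = a + \<alpha>"
  define y where "y = a - \<beta>"
  define c where "c = 1 - y / x"
  \<comment> \<open>The level for Markov's inequality: the value of the quadratic function at mean
    \<open>x\<close> and variance over time \<open>b / \<epsilon>\<close>.\<close>
  define F where "F = (x - y)\<^sup>2 + c * (b / \<epsilon>)"
  have \<alpha>2: "\<alpha>\<^sup>2 = (1 - \<epsilon>) / \<epsilon> * v" and \<beta>2: "\<beta>\<^sup>2 = \<epsilon> / (1 - \<epsilon>) * v"
    using v \<epsilon> by (auto simp: \<alpha>_def \<beta>_def)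
  have "\<alpha> * \<beta> = sqrt (((1 - \<epsilon>) / \<epsilon> * v) * (\<epsilon> / (1 - \<epsilon>) * v))"
    unfolding \<alpha>_def \<beta>_def by (rule real_sqrt_mult[symmetric])
  also have "((1 - \<epsilon>) / \<epsilon> * v) * (\<epsilon> / (1 - \<epsilon>) * v) = v\<^sup>2"
    using \<epsilon> by (simp add: power2_eq_square)
  finally have \<alpha>\<beta>: "\<alpha> * \<beta> = v" using v by simp
  have pos: "\<alpha> > 0" "\<beta> > 0" using v \<epsilon> by (auto simp: \<alpha>_def \<beta>_def)
  then have xy: "0 < y" "y < x" "0 < x" using y_pos[folded \<beta>_def] by (auto simp: x_def y_def)
  have c: "0 < c" using xy by (simp add: c_def)
  \<comment> \<open>Both sides are the expectation of \<open>(m - y)\<^sup>2\<close>: on the left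
    from mean and variance, on the right from the two-point distribution, where only
    \<open>x\<close> contributes.\<close>
  have \<epsilon>xy: "\<beta>\<^sup>2 + v = \<epsilon> * (x - y)\<^sup>2"
  proof -
    have "(x - y)\<^sup>2 = \<alpha>\<^sup>2 + 2 * (\<alpha> * \<beta>) + \<beta>\<^sup>2" by (simp add: x_def y_def power2_eq_square algebra_simps)
    then show ?thesis unfolding \<alpha>\<beta> \<alpha>2 \<beta>2 using \<epsilon> by (simp add: field_simps)
  qed
  have F: "F > 0" using xy c b \<epsilon> by (auto simp: F_def intro!: add_pos_nonneg)
  define D where "D z = (\<Sum>t<T. pf_dev N \<mu> w t z) / T" for z
  define f where "f z = (a - D z - y)\<^sup>2 + c * (mean_sq T N \<mu> w z - (a - D z)\<^sup>2)" for z
  note D = mean_pf_dev_moments[OF P T, where w = w, folded D_def]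
  note Q = mean_sq_expectation[OF P T \<rho>0, of w]
  \<comment> \<open>Expanded in this way, \<open>f\<close> has an expectation determined by moments
    that are the same for every \<open>P\<close> in the ambiguity set.\<close>
  have f_eq: "f = (\<lambda>z. (\<beta>\<^sup>2 - c * a\<^sup>2) + (2 * c * a - 2 * \<beta>) * D z + (1 - c) * (D z)\<^sup>2 + c * mean_sq T N \<mu> w z)"
    by (rule ext) (simp add: f_def y_def power2_eq_square algebra_simps)
  have f_int: "integrable P f" unfolding f_eq using D Q by simp
  have "(\<integral>z. f z \<partial>P) = \<epsilon> * F"
  proof -
    have "(\<integral>z. f z \<partial>P) = \<beta>\<^sup>2 - c * a\<^sup>2 + (1 - c) * v + c * (a\<^sup>2 + quad_form N \<Sigma> w)"
      unfolding f_eq using D Q by (simp add: prob_space v_def a_def)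
    also have "\<dots> = (\<beta>\<^sup>2 + v) + c * b" by (simp add: b_def algebra_simps)
    also have "\<dots> = \<epsilon> * F" unfolding \<epsilon>xy F_def using \<epsilon> by (simp add: algebra_simps)
    finally show ?thesis .
  qed
  moreover have "0 \<le> f z" for z
  proof -
    have "a - D z = (\<Sum>t<T. a - pf_dev N \<mu> w t z) / T"
      using T by (simp add: D_def sum_subtractf field_simps)
    then have "(a - D z)\<^sup>2 \<le> mean_sq T N \<mu> w z"
      unfolding mean_sq_def a_def[symmetric] using sum_average_squared_le[OF T] by simp
    then show ?thesis using c by (simp add: f_def)
  qed
  ultimately have markov: "measure P {z \<in> space P. f z \<ge> F} \<le> \<epsilon>"
    using integral_Markov_inequality_measure[OF f_int, of "{}" F] F by simp
  have [measurable]: "f \<in> borel_measurable P" using f_int by auto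
  have "measure P {z \<in> space P. mean_sq T N \<mu> w z > x\<^sup>2 + b / \<epsilon>} \<le> measure P {z \<in> space P. f z \<ge> F}"
  proof (rule finite_measure_mono)
    show "{z \<in> space P. mean_sq T N \<mu> w z > x\<^sup>2 + b / \<epsilon>} \<subseteq> {z \<in> space P. f z \<ge> F}"
      by (auto simp: f_def F_def c_def simp del: times_divide_eq_right intro!: mean_sq_decomposition_ge xy)
  qed simp
  then show ?thesis using markov by (simp add: x_def \<alpha>_def)
qed

lemma growth_probability_ge:
  assumes P: "P \<in> ambiguity_set T N \<mu> \<Sigma> \<rho>" and T: "T > 0"
    and tail: "measure P {z \<in> space P. mean_sq T N \<mu> w z > 1 - 2 * g} \<le> \<epsilon>"
  shows "measure P {z \<in> space P. growth_sum T N w z \<ge> g} \<ge> 1 - \<epsilon>"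
proof -
  interpret prob_space P using P by (simp add: ambiguity_set_def)
  have [measurable]: "mean_sq T N \<mu> w \<in> borel_measurable P"
    using borel_measurable_mean_sq measurable_cong_sets[OF borel_measurable_ambiguity[OF P] refl] by blast
  have "{z \<in> space P. growth_sum T N w z \<ge> g} = space P - {z \<in> space P. mean_sq T N \<mu> w z > 1 - 2 * g}"
    by (auto simp: growth_sum_eq_mean_sq[OF T, of N w _ \<mu>] field_simps)
  then show ?thesis using tail by (simp add: prob_compl)
qed

text \<open>Growth at least \<open>g\<close> means \<open>mean_sq\<close> at most
  \<open>1 - 2 * g\<close>; the strict inequality \<open>g\<close> makes this disjoint from the
  closed tail event.\<close>

lemma growth_probability_le:
  assumes P: "P \<in> ambiguity_set T N \<mu> \<Sigma> \<rho>" and T: "T > 0"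
    and tail: "measure P {z \<in> space P. mean_sq T N \<mu> w z \<ge> q} \<ge> \<epsilon>" and g: "1 - 2 * g < q"
  shows "measure P {z \<in> space P. growth_sum T N w z \<ge> g} \<le> 1 - \<epsilon>"
proof -
  interpret prob_space P using P by (simp add: ambiguity_set_def)
  have [measurable]: "mean_sq T N \<mu> w \<in> borel_measurable P"
    using borel_measurable_mean_sq measurable_cong_sets[OF borel_measurable_ambiguity[OF P] refl] by blast
  have "{z \<in> space P. growth_sum T N w z \<ge> g} \<subseteq> space P - {z \<in> space P. mean_sq T N \<mu> w z \<ge> q}"
    using g by (auto simp: growth_sum_eq_mean_sq[OF T, of N w _ \<mu>] field_simps)
  then have "measure P {z \<in> space P. growth_sum T N w z \<ge> g} \<le> measure P (space P - {z \<in> space P. mean_sq T N \<mu> w z \<ge> q})"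
    by (intro finite_measure_mono) auto
  then show ?thesis using tail by (simp add: prob_compl)
qed

section \<open>The extremal distributions\<close>

text \<open>The Boolean selects the adverse event, of probability \<open>e\<close>; the indices pick
  columns of square roots over time and over assets; the last component is a random sign. Finite
  support turns expectations into finite sums.\<close>

definition scenario_pmf :: "real \<Rightarrow> nat \<Rightarrow> nat \<Rightarrow> (bool \<times> nat \<times> nat \<times> real) pmf" where
  "scenario_pmf e T N =
    pair_pmf (bernoulli_pmf e) (pair_pmf (pmf_of_set {..<T}) (pair_pmf (pmf_of_set {..<N}) (pmf_of_set {-1, 1})))"

context
  fixes e :: real and T N :: nat
  assumes e: "0 < e" "e < 1" and TN: "T > 0" "N > 0"
begin

lemma set_scenario_pmf: "set_pmf (scenario_pmf e T N) = UNIV \<times> {..<T} \<times> {..<N} \<times> {-1, 1}"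
proof -
  have "{..<T} \<noteq> {}" "{..<N} \<noteq> {}" using TN by auto
  then show ?thesis using e by (simp add: scenario_pmf_def set_pmf_bernoulli)
qed

lemma integrable_scenario_pmf: "integrable (scenario_pmf e T N) (f :: _ \<Rightarrow> real)"
  by (rule integrable_measure_pmf_finite) (simp add: set_scenario_pmf)

lemma integral_scenario_pmf:
  fixes f :: "_ \<Rightarrow> real"
  shows "(\<integral>\<omega>. f \<omega> \<partial>scenario_pmf e T N) =
    (\<Sum>u<T. \<Sum>k<N. e * (f (True, u, k, 1) + f (True, u, k, -1)) +
      (1 - e) * (f (False, u, k, 1) + f (False, u, k, -1))) / (2 * real T * real N)"
proof -
  let ?A = "(UNIV :: bool set) \<times> {..<T} \<times> {..<N} \<times> {-1, 1 :: real}"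
  have ne: "{..<T} \<noteq> {}" "{..<N} \<noteq> {}" using TN by auto
  have pmf: "pmf (scenario_pmf e T N) (c, u, k, g) = (if c then e else 1 - e) / (2 * real T * real N)"
    if "u < T" "k < N" "g \<in> {-1, 1}" for c u k g
    using that e ne by (simp add: scenario_pmf_def pmf_pair pmf_of_set)
  have "(\<integral>\<omega>. f \<omega> \<partial>scenario_pmf e T N) = (\<Sum>\<omega>\<in>?A. f \<omega> * pmf (scenario_pmf e T N) \<omega>)"
    by (rule integral_measure_pmf_real) (auto simp: set_scenario_pmf)
  also have "\<dots> = (\<Sum>c\<in>UNIV. \<Sum>u<T. \<Sum>k<N. \<Sum>g\<in>{-1, 1}. f (c, u, k, g) * pmf (scenario_pmf e T N) (c, u, k, g))"
    by (simp only: sum.cartesian_product case_prod_unfold prod.collapse)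
  also have "\<dots> = (\<Sum>c\<in>UNIV. \<Sum>u<T. \<Sum>k<N. \<Sum>g\<in>{-1, 1}. f (c, u, k, g) * ((if c then e else 1 - e) / (2 * real T * real N)))"
    using pmf by (intro sum.cong refl) auto
  also have "\<dots> = (\<Sum>u<T. \<Sum>k<N. (e * (f (True, u, k, 1) + f (True, u, k, -1)) +
      (1 - e) * (f (False, u, k, 1) + f (False, u, k, -1))) / (2 * real T * real N))"
    unfolding UNIV_bool
    by (simp add: sum.distrib[symmetric] add_divide_distrib diff_divide_distrib algebra_simps)
  finally show ?thesis by (simp add: sum_divide_distrib)
qed

lemma prob_scenario_True: "measure (scenario_pmf e T N) {\<omega>. fst \<omega>} = e"
proof -
  have "measure (scenario_pmf e T N) {\<omega>. fst \<omega>} = measure (map_pmf fst (scenario_pmf e T N)) {True}"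
    by (simp add: vimage_def)
  also have "\<dots> = e"
    unfolding scenario_pmf_def map_fst_pair_pmf measure_pmf_single using e by simp
  finally show ?thesis .
qed

end

text \<open>Deviations from the mean are \<open>h i * A + g * (\<dots> * R i k)\<close> with \<open>h = \<Sigma> w / (w\<^sup>T \<Sigma> w)\<close>.  As \<open>w\<^sup>T h = 1\<close> and
  \<open>w\<^sup>T R = 0\<close>, the portfolio sees only \<open>A\<close>; the second summand supplies the rest of the asset
  covariance, and its random sign \<open>g\<close> makes it uncorrelated with \<open>A\<close> without independence.\<close>

lemma ex_worst_case_distribution:
  fixes e :: real and \<mu> :: "nat \<Rightarrow> real"
  assumes T: "T > 0" and N: "N > 0" and e: "0 < e" "e < 1"
    and \<Sigma>: "pos_def N \<Sigma>" and C: "pos_def T (circ T \<rho>)" and \<rho>0: "\<rho> 0 = 1"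
    and w: "quad_form N \<Sigma> w > 0"
  defines "a \<equiv> 1 - dotp N w \<mu>" and "v \<equiv> quad_form N \<Sigma> w * (\<Sum>k<T. \<rho> k) / T"
  defines "b \<equiv> quad_form N \<Sigma> w - v"
  shows "\<exists>P\<in>ambiguity_set T N \<mu> \<Sigma> \<rho>.
    measure P {z \<in> space P. mean_sq T N \<mu> w z \<ge> (a + sqrt ((1 - e) / e * v))\<^sup>2 + b / e} \<ge> e"
proof -
  let ?C = "circ T \<rho>"
  define l where "l = (\<Sum>k<T. \<rho> k)"
  define q where "q = quad_form N \<Sigma> w"
  have l: "l > 0" unfolding l_def by (rule sum_circ_weights_pos[OF T C])
  have q: "q > 0" using w by (simp add: q_def)
  have v_eq: "v = q * l / T" by (simp add: v_def q_def l_def)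
  have v: "v > 0" using l q T by (simp add: v_eq)
  obtain B where B: "pos_semidef T B" "quad_form T B (\<lambda>_. 1) = 0"
    "\<And>s t. s < T \<Longrightarrow> t < T \<Longrightarrow> B s t = ?C s t - l / T"
    using pos_semidef_circ_centered[OF T C] by (auto simp: l_def)
  obtain S\<^sub>0 where "pos_semidef T S\<^sub>0"
    and S0: "\<And>s t. s < T \<Longrightarrow> t < T \<Longrightarrow> (\<Sum>u<T. S\<^sub>0 s u * S\<^sub>0 u t) = B s t"
    using ex_psd_sqrt[OF B(1)] by blast
  then have S0_sym: "sym_mat T S\<^sub>0" by (simp add: pos_semidef_def)
  \<comment> \<open>The form of \<open>B\<close> vanishes at the all-ones vector, so its root
    annihilates that vector.\<close>
  have S0_row: "(\<Sum>t<T. S\<^sub>0 u t) = 0" if "u < T" for u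
    using dotp_self_eq_0[OF dotp_mat_vec_self[OF S0_sym S0, of "\<lambda>_. 1", unfolded B(2)] that]
    by (simp add: mat_vec_def)
  have S0_col: "(\<Sum>t<T. S\<^sub>0 t u) = 0" if "u < T" for u
    using S0_row[OF that] S0_sym that by (simp add: sym_mat_def)
  have S0_cov: "(\<Sum>u<T. S\<^sub>0 s u * S\<^sub>0 t u) = ?C s t - l / T" if "s < T" "t < T" for s t
    using S0[OF that] B(3)[OF that] S0_sym that by (simp add: sym_mat_def)
  have S0_norm: "(\<Sum>t<T. S\<^sub>0 t u * S\<^sub>0 t u) = 1 - l / T" if "u < T" for u
    using S0_cov[OF that that] S0_sym that \<rho>0 by (simp add: sym_mat_def circ_def)
  \<comment> \<open>The root of the uncentered matrix gives the residual asset risk its full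
    correlation over time.\<close>
  obtain S where "pos_semidef T S"
    and S: "\<And>s t. s < T \<Longrightarrow> t < T \<Longrightarrow> (\<Sum>u<T. S s u * S u t) = ?C s t"
    using ex_psd_sqrt[OF pos_def_imp_semidef[OF C]] by blast
  then have S_cov: "(\<Sum>u<T. S s u * S t u) = ?C s t" if "s < T" "t < T" for s t
    using S[OF that] that by (simp add: sym_mat_def pos_semidef_def)
  define h where "h i = mat_vec N \<Sigma> w i / q" for i
  define \<Sigma>' where "\<Sigma>' i j = \<Sigma> i j - mat_vec N \<Sigma> w i * mat_vec N \<Sigma> w j / q" for i j
  have \<Sigma>'_split: "h i * h j * q + \<Sigma>' i j = \<Sigma> i j" for i j
    using q by (simp add: h_def \<Sigma>'_def)
  have wh: "(\<Sum>i<N. w i * h i) = 1"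
    using q by (simp add: h_def q_def quad_form_dotp dotp_def flip: sum_divide_distrib)
  note \<Sigma>' = pos_semidef_deflate[OF pos_def_imp_semidef[OF \<Sigma>] w, folded q_def, folded \<Sigma>'_def]
  obtain R where "pos_semidef N R"
    and R: "\<And>i j. i < N \<Longrightarrow> j < N \<Longrightarrow> (\<Sum>k<N. R i k * R k j) = \<Sigma>' i j"
    using ex_psd_sqrt[OF \<Sigma>'(1)] by blast
  then have R_sym: "sym_mat N R" by (simp add: pos_semidef_def)
  have R_cov: "(\<Sum>k<N. R i k * R j k) = \<Sigma>' i j" if "i < N" "j < N" for i j
    using R[OF that] R_sym that by (simp add: sym_mat_def)
  \<comment> \<open>The deflated form vanishes at \<open>w\<close>, so its root annihilates
    \<open>w\<close>.\<close>
  have wR: "(\<Sum>i<N. w i * R i k) = 0" if "k < N" for k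
    using dotp_self_eq_0[OF dotp_mat_vec_self[OF R_sym R, of w, unfolded \<Sigma>'(2)] that] R_sym that
    by (simp add: mat_vec_def sym_mat_def mult.commute)

  define \<alpha> where "\<alpha> = sqrt ((1 - e) / e * v)"
  define \<beta> where "\<beta> = sqrt (e / (1 - e) * v)"
  \<comment> \<open>The scale makes up for two dilutions: the factor \<open>1 / T\<close> of the
    uniform column \<open>u\<close>, and the factor \<open>e\<close> because only the adverse event
    has variation over time.\<close>
  define \<zeta> where "\<zeta> = sqrt (q * T / e)"
  define A where "A c t u = (if c then - (\<alpha> + \<zeta> * S\<^sub>0 t u) else \<beta>)" for c :: bool and t u
  \<comment> \<open>Likewise \<open>sqrt (T * N)\<close> offsets the uniform choice of the columns
    \<open>u\<close> and \<open>k\<close>.\<close>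
  define \<delta> where "\<delta> = (\<lambda>(c, u, k, g) (t, i). h i * A c t u + g * (sqrt (T * N) * S t u * R i k))"
  define X where "X \<omega> = restrict (\<lambda>(t, i). \<mu> i + \<delta> \<omega> (t, i)) ({..<T} \<times> {..<N})" for \<omega>
  define M where "M = scenario_pmf e T N"
  define P where "P = distr M (returns_space T N) X"
  note E = integral_scenario_pmf[OF e T N, folded M_def]
  have \<alpha>2: "\<alpha>\<^sup>2 = (1 - e) / e * v" and \<beta>2: "\<beta>\<^sup>2 = e / (1 - e) * v" and \<zeta>2: "\<zeta>\<^sup>2 = q * T / e"
    using v e q by (auto simp: \<alpha>_def \<beta>_def \<zeta>_def)
  have \<alpha>\<beta>: "e * \<alpha> = (1 - e) * \<beta>"
  proof (rule power2_eq_imp_eq)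
    show "(e * \<alpha>)\<^sup>2 = ((1 - e) * \<beta>)\<^sup>2"
      unfolding power_mult_distrib \<alpha>2 \<beta>2 using e by (simp add: power2_eq_square)
  qed (use e v in \<open>auto simp: \<alpha>_def \<beta>_def\<close>)

  have mean_\<delta>: "(\<integral>\<omega>. \<delta> \<omega> (t, i) \<partial>M) = 0" if "t < T" for t i
  proof -
    have "(\<integral>\<omega>. \<delta> \<omega> (t, i) \<partial>M) = (\<Sum>u<T. \<Sum>k<N. 2 * h i * (e * A True t u + (1 - e) * A False t u)) / (2 * real T * real N)"
      unfolding E \<delta>_def by (simp add: algebra_simps)
    also have "\<dots> = (\<Sum>u<T. (2 * real N * h i * - (e * \<zeta>)) * S\<^sub>0 t u) / (2 * real T * real N)"
      using \<alpha>\<beta> by (simp add: A_def algebra_simps)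
    also have "\<dots> = 0" unfolding sum_distrib_left[symmetric] S0_row[OF that] by simp
    finally show ?thesis .
  qed
  have cov_\<delta>: "(\<integral>\<omega>. \<delta> \<omega> (s, i) * \<delta> \<omega> (t, j) \<partial>M) = ?C s t * \<Sigma> i j"
    if "s < T" "t < T" "i < N" "j < N" for s t i j
  proof -
    \<comment> \<open>The product of the \<open>A\<close> terms averaged over the Boolean for fixed
      \<open>u\<close>. The cross terms with the residual are odd in \<open>g\<close> and
      cancel.\<close>
    define G where "G u = e * (A True s u * A True t u) + (1 - e) * (A False s u * A False t u)" for u
    have "(\<integral>\<omega>. \<delta> \<omega> (s, i) * \<delta> \<omega> (t, j) \<partial>M) =
      (\<Sum>u<T. \<Sum>k<N. 2 * (h i * h j * G u) + 2 * ((sqrt (T * N))\<^sup>2 * ((S s u * S t u) * (R i k * R j k)))) / (2 * real T * real N)"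
      unfolding E \<delta>_def G_def by (simp add: algebra_simps power2_eq_square)
    also have "\<dots> = (2 * real N * (h i * h j * (\<Sum>u<T. G u)) +
        2 * real (T * N) * ((\<Sum>u<T. S s u * S t u) * (\<Sum>k<N. R i k * R j k))) / (2 * real T * real N)"
      by (simp add: sum.distrib sum_distrib_left sum_product mult_ac)
    also have "\<dots> = h i * h j * ((\<Sum>u<T. G u) / T) + ?C s t * \<Sigma>' i j"
      unfolding S_cov[OF that(1,2)] R_cov[OF that(3,4)] using T N by (simp add: field_simps)
    also have "(\<Sum>u<T. G u) / T = q * ?C s t"
    proof -
      \<comment> \<open>The terms linear in \<open>S\<^sub>0\<close> sum to 0 over \<open>u\<close>;
        the quadratic one restores the centered part of the circulant matrix, and \<open>v\<close>
        its constant part.\<close>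
      have "G u = v + (e * \<alpha> * \<zeta>) * S\<^sub>0 s u + (e * \<alpha> * \<zeta>) * S\<^sub>0 t u + q * T * (S\<^sub>0 s u * S\<^sub>0 t u)" for u
      proof -
        have "G u = (e * \<alpha>\<^sup>2 + (1 - e) * \<beta>\<^sup>2) + (e * \<alpha> * \<zeta>) * S\<^sub>0 s u + (e * \<alpha> * \<zeta>) * S\<^sub>0 t u + (e * \<zeta>\<^sup>2) * (S\<^sub>0 s u * S\<^sub>0 t u)"
          by (simp add: G_def A_def power2_eq_square algebra_simps)
        moreover have "e * \<alpha>\<^sup>2 = (1 - e) * v" "(1 - e) * \<beta>\<^sup>2 = e * v" "e * \<zeta>\<^sup>2 = q * T"
          unfolding \<alpha>2 \<beta>2 \<zeta>2 using e by simp_all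
        ultimately show ?thesis by (simp add: algebra_simps)
      qed
      then have "(\<Sum>u<T. G u) = T * v + (e * \<alpha> * \<zeta>) * (\<Sum>u<T. S\<^sub>0 s u) + (e * \<alpha> * \<zeta>) * (\<Sum>u<T. S\<^sub>0 t u)
          + q * T * (\<Sum>u<T. S\<^sub>0 s u * S\<^sub>0 t u)"
        by (simp add: sum.distrib sum_distrib_left)
      then show ?thesis
        unfolding S0_row[OF that(1)] S0_row[OF that(2)] S0_cov[OF that(1,2)] v_eq using T
        by (simp add: field_simps)
    qed
    also have "h i * h j * (q * ?C s t) + ?C s t * \<Sigma>' i j = ?C s t * (h i * h j * q + \<Sigma>' i j)"
      by (simp add: algebra_simps)
    finally show ?thesis unfolding \<Sigma>'_split .
  qed

  have X_meas: "X \<in> measurable M (returns_space T N)"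
    by (auto simp: X_def returns_space_def space_PiM)
  have coord: "(\<lambda>x. x (t, i)) \<in> borel_measurable (returns_space T N)" if "t < T" "i < N" for t i
    unfolding returns_space_def using that by (intro measurable_component_singleton) auto
  have X_coord: "X \<omega> (t, i) = \<mu> i + \<delta> \<omega> (t, i)" if "t < T" "i < N" for \<omega> t i
    using that by (simp add: X_def)
  have P: "P \<in> ambiguity_set T N \<mu> \<Sigma> \<rho>"
    unfolding ambiguity_set_def
  proof (intro CollectI conjI allI impI)
    show "prob_space P" unfolding P_def using X_meas by (intro measure_pmf.prob_space_distr)
    show "sets P = sets (returns_space T N)" by (simp add: P_def)
    fix s t i j assume st: "s < T" "t < T" and ij: "i < N" "j < N"
    note [measurable] = coord[OF st(1) ij(1)] coord[OF st(2) ij(2)]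
    show "integrable P (\<lambda>x. (x (s, i))\<^sup>2)"
      unfolding P_def using integrable_scenario_pmf[OF e T N, folded M_def]
      by (subst integrable_distr_eq[OF X_meas]) auto
    have "(\<integral>x. x (t, j) \<partial>P) = (\<integral>\<omega>. \<mu> j + \<delta> \<omega> (t, j) \<partial>M)"
      unfolding P_def using st ij by (subst integral_distr[OF X_meas]) (auto simp: X_coord)
    also have "\<dots> = \<mu> j"
      using mean_\<delta>[OF st(2), of j] integrable_scenario_pmf[OF e T N, folded M_def]
      by (subst Bochner_Integration.integral_add) (auto simp: measure_pmf.prob_space)
    finally show "(\<integral>x. x (t, j) \<partial>P) = \<mu> j" .
    have "(\<integral>x. (x (s, i) - \<mu> i) * (x (t, j) - \<mu> j) \<partial>P) = (\<integral>\<omega>. \<delta> \<omega> (s, i) * \<delta> \<omega> (t, j) \<partial>M)"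
      unfolding P_def using st ij by (subst integral_distr[OF X_meas]) (auto simp: X_coord)
    then show "(\<integral>x. (x (s, i) - \<mu> i) * (x (t, j) - \<mu> j) \<partial>P) = ?C s t * \<Sigma> i j"
      using cov_\<delta>[OF st ij] by simp
  qed

  have Q: "mean_sq T N \<mu> w (X (True, u, k, g)) = (a + \<alpha>)\<^sup>2 + b / e" if "u < T" "k < N" for u k g
  proof -
    have "pf_dev N \<mu> w t (X (True, u, k, g)) = A True t u" if "t < T" for t
    proof -
      have "pf_dev N \<mu> w t (X (True, u, k, g)) =
          (\<Sum>i<N. w i * h i * A True t u + g * sqrt (T * N) * S t u * (w i * R i k))"
        unfolding pf_dev_def using that by (intro sum.cong) (auto simp: X_coord \<delta>_def algebra_simps)
      also have "\<dots> = (\<Sum>i<N. w i * h i) * A True t u + g * sqrt (T * N) * S t u * (\<Sum>i<N. w i * R i k)"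
        by (simp add: sum.distrib sum_distrib_left sum_distrib_right)
      finally show ?thesis using wh wR[OF \<open>k < N\<close>] by simp
    qed
    then have "mean_sq T N \<mu> w (X (True, u, k, g)) = (\<Sum>t<T. (a - A True t u)\<^sup>2) / T"
      by (simp add: mean_sq_def a_def)
    also have "(\<Sum>t<T. (a - A True t u)\<^sup>2) =
        (\<Sum>t<T. (a + \<alpha>)\<^sup>2 + 2 * (a + \<alpha>) * \<zeta> * S\<^sub>0 t u + \<zeta>\<^sup>2 * (S\<^sub>0 t u * S\<^sub>0 t u))"
      by (simp add: A_def power2_eq_square algebra_simps)
    also have "\<dots> = T * (a + \<alpha>)\<^sup>2 + 2 * (a + \<alpha>) * \<zeta> * (\<Sum>t<T. S\<^sub>0 t u) + \<zeta>\<^sup>2 * (\<Sum>t<T. S\<^sub>0 t u * S\<^sub>0 t u)"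
      by (simp add: sum.distrib sum_distrib_left)
    also have "\<dots> / T = (a + \<alpha>)\<^sup>2 + q * (1 - l / T) / e"
      unfolding S0_col[OF that(1)] S0_norm[OF that(1)] \<zeta>2 using T e by (simp add: field_simps)
    also have "q * (1 - l / T) = b" by (simp add: b_def v_eq q_def[symmetric] algebra_simps)
    finally show ?thesis .
  qed
  let ?E = "{z \<in> space (returns_space T N). mean_sq T N \<mu> w z \<ge> (a + \<alpha>)\<^sup>2 + b / e}"
  have "e = measure M {\<omega>. fst \<omega>}"
    unfolding M_def by (rule prob_scenario_True[OF e T N, symmetric])
  also have "\<dots> \<le> measure M (X -` ?E)"
  proof (rule measure_pmf.finite_measure_mono_AE)
    have "X \<omega> \<in> space (returns_space T N)" for \<omega> using X_meas by auto
    \<comment> \<open>\<open>Q\<close> needs the indices in range, which holds on the support of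
      \<open>M\<close>.\<close>
    then show "AE \<omega> in M. \<omega> \<in> {\<omega>. fst \<omega>} \<longrightarrow> \<omega> \<in> X -` ?E"
      using Q by (auto simp: AE_measure_pmf_iff M_def set_scenario_pmf[OF e T N])
  qed simp
  also have "\<dots> = measure P ?E"
    unfolding P_def by (subst measure_distr[OF X_meas]) auto
  finally show ?thesis using P by (intro bexI[of _ P]) (auto simp: \<alpha>_def P_def)
qed

section \<open>The worst-case growth rate\<close>

text \<open>Growth is identically 0, so exactly the levels up to 0 are feasible. Nonemptiness of the
  ambiguity set matters: over an empty set every level would be feasible.\<close>

lemma worst_case_growth_zero_variance:
  assumes T: "T > 0" and N: "N > 0" and \<epsilon>: "0 < \<epsilon>" "\<epsilon> < 1"
    and \<Sigma>: "pos_def N \<Sigma>" and C: "pos_def T (circ T \<rho>)" and \<rho>0: "\<rho> 0 = 1"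
    and w: "\<And>i. i < N \<Longrightarrow> w i = 0"
  shows "worst_case_growth T N \<epsilon> \<mu> \<Sigma> \<rho> w = 0"
proof -
  \<comment> \<open>The all-ones portfolio serves only to obtain some member of the ambiguity
    set.\<close>
  have "quad_form N \<Sigma> (\<lambda>_. 1) > 0" using \<Sigma> N by (auto simp: pos_def_def)
  then obtain P\<^sub>0 where P0: "P\<^sub>0 \<in> ambiguity_set T N \<mu> \<Sigma> \<rho>"
    using ex_worst_case_distribution[OF T N \<epsilon> \<Sigma> C \<rho>0] by blast
  have "growth_sum T N w x = 0" for x using w by (simp add: growth_sum_def)
  then have prob: "measure P {x \<in> space P. growth_sum T N w x \<ge> g} = (if g \<le> 0 then 1 else 0)"
    if "P \<in> ambiguity_set T N \<mu> \<Sigma> \<rho>" for P g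
    using that by (auto simp: ambiguity_set_def prob_space.prob_space)
  then have "{g. \<forall>P\<in>ambiguity_set T N \<mu> \<Sigma> \<rho>.
      measure P {x \<in> space P. growth_sum T N w x \<ge> g} \<ge> 1 - \<epsilon>} = {..0}"
    using P0 \<epsilon> by (auto split: if_splits)
  then show ?thesis by (simp add: worst_case_growth_def)
qed

text \<open>The supremum is a maximum: the tail bound makes the claimed value feasible, and the
  extremal distributions refute every larger one.\<close>

lemma worst_case_growth_eq:
  fixes \<epsilon> :: real and \<mu> w :: "nat \<Rightarrow> real"
  assumes T: "T > 0" and N: "N > 0" and \<epsilon>: "0 < \<epsilon>" "\<epsilon> < 1"
    and \<Sigma>: "pos_def N \<Sigma>" and C: "pos_def T (circ T \<rho>)" and \<rho>0: "\<rho> 0 = 1"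
    and w: "quad_form N \<Sigma> w > 0"
  defines "a \<equiv> 1 - dotp N w \<mu>" and "v \<equiv> quad_form N \<Sigma> w * (\<Sum>k<T. \<rho> k) / T"
  defines "b \<equiv> quad_form N \<Sigma> w - v"
  assumes y_pos: "a > sqrt (\<epsilon> / (1 - \<epsilon>) * v)"
  shows "worst_case_growth T N \<epsilon> \<mu> \<Sigma> \<rho> w =
    (1 - ((a + sqrt ((1 - \<epsilon>) / \<epsilon> * v))\<^sup>2 + b / \<epsilon>)) / 2"
proof -
  define K where "K e = (a + sqrt ((1 - e) / e * v))\<^sup>2 + b / e" for e
  have v: "v > 0"
    unfolding v_def using w T sum_circ_weights_pos[OF T C] by simp
  have b: "b \<ge> 0"
    unfolding b_def v_def using w T sum_circ_weights_le[of T \<rho>, OF T C \<rho>0] by (simp add: field_simps)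
  have "Sup {g. \<forall>P\<in>ambiguity_set T N \<mu> \<Sigma> \<rho>.
      measure P {x \<in> space P. growth_sum T N w x \<ge> g} \<ge> 1 - \<epsilon>} = (1 - K \<epsilon>) / 2"
  proof (rule cSup_eq_maximum)
    show "(1 - K \<epsilon>) / 2 \<in> {g. \<forall>P\<in>ambiguity_set T N \<mu> \<Sigma> \<rho>.
      measure P {x \<in> space P. growth_sum T N w x \<ge> g} \<ge> 1 - \<epsilon>}"
    proof (intro CollectI ballI)
      fix P assume P: "P \<in> ambiguity_set T N \<mu> \<Sigma> \<rho>"
      show "1 - \<epsilon> \<le> measure P {x \<in> space P. growth_sum T N w x \<ge> (1 - K \<epsilon>) / 2}"
      proof (rule growth_probability_ge[OF P T])
        have "1 - 2 * ((1 - K \<epsilon>) / 2) = K \<epsilon>" by (simp add: field_simps)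
        then show "measure P {z \<in> space P. mean_sq T N \<mu> w z > 1 - 2 * ((1 - K \<epsilon>) / 2)} \<le> \<epsilon>"
          using mean_sq_tail_le[OF P T \<rho>0 \<epsilon>, of w, folded v_def a_def, folded b_def, OF v b y_pos]
          by (simp only: K_def)
      qed
    qed
  next
    fix g assume g: "g \<in> {g. \<forall>P\<in>ambiguity_set T N \<mu> \<Sigma> \<rho>.
      measure P {x \<in> space P. growth_sum T N w x \<ge> g} \<ge> 1 - \<epsilon>}"
    show "g \<le> (1 - K \<epsilon>) / 2"
    proof (rule ccontr)
      assume "\<not> ?thesis"
      then have "1 - 2 * g < K \<epsilon>" by simp
      \<comment> \<open>Continuity of \<open>K\<close> leaves room for some
        \<open>e > \<epsilon>\<close> with \<open>K e\<close> still above
        \<open>1 - 2 * g\<close>.\<close>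
      moreover have "(K \<longlongrightarrow> K \<epsilon>) (at_right \<epsilon>)"
        unfolding K_def using \<epsilon> by (intro tendsto_intros) auto
      ultimately have "\<forall>\<^sub>F e in at_right \<epsilon>. 1 - 2 * g < K e" by (rule order_tendstoD[rotated])
      moreover have "\<forall>\<^sub>F e in at_right \<epsilon>. \<epsilon> < e \<and> e < 1"
        using eventually_at_right_less[of \<epsilon>] eventually_at_right_real[OF \<epsilon>(2)]
        by eventually_elim auto
      ultimately have "\<forall>\<^sub>F e in at_right \<epsilon>. 1 - 2 * g < K e \<and> \<epsilon> < e \<and> e < 1"
        by eventually_elim auto
      then obtain e where e: "1 - 2 * g < K e" "\<epsilon> < e" "e < 1"
        using eventually_happens trivial_limit_at_right_real by blast
      then have "0 < e" using \<epsilon> by simp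
      then obtain P where P: "P \<in> ambiguity_set T N \<mu> \<Sigma> \<rho>"
        and tail: "measure P {z \<in> space P. mean_sq T N \<mu> w z \<ge> K e} \<ge> e"
        using ex_worst_case_distribution[OF T N \<open>0 < e\<close> e(3) \<Sigma> C \<rho>0 w, of \<mu>]
        unfolding K_def b_def a_def v_def by blast
      \<comment> \<open>The bound \<open>1 - e\<close> is strictly below
        \<open>1 - \<epsilon>\<close>, which contradicts feasibility of \<open>g\<close>.\<close>
      have "measure P {x \<in> space P. growth_sum T N w x \<ge> g} \<le> 1 - e"
        by (rule growth_probability_le[OF P T tail e(1)])
      then show False using g P e(2) by fastforce
    qed
  qed
  then show ?thesis by (simp add: worst_case_growth_def K_def)
qed

theorem theorem4p3:
  fixes T N :: nat and \<epsilon> :: real and \<mu> w :: "nat \<Rightarrow> real"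
    and \<Sigma> :: "nat \<Rightarrow> nat \<Rightarrow> real" and \<rho> :: "nat \<Rightarrow> real"
  assumes "T \<ge> 2" and "N \<ge> 1" and "0 < \<epsilon>" and "\<epsilon> < 1"
    and "pos_def N \<Sigma>"
    and "\<rho> 0 = 1" and "\<forall>t\<in>{1..T-1}. \<rho> t = \<rho> (T - t)"
    and "pos_def T (circ T \<rho>)"
    and "\<forall>i<N. w i \<ge> 0"
    and "1 - dotp N w \<mu> >
           sqrt ((1 + (real T - 1) * ((\<Sum>t=1..T-1. \<rho> t) / (real T - 1))) * \<epsilon> / ((1 - \<epsilon>) * real T))
           * vnorm N (mat_vec N (psd_sqrt N \<Sigma>) w)"
  shows "worst_case_growth T N \<epsilon> \<mu> \<Sigma> \<rho> w =
    1/2 * (1 - (1 - dotp N w \<mu>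
        + sqrt ((1 - \<epsilon>) * (1 + (real T - 1) * ((\<Sum>t=1..T-1. \<rho> t) / (real T - 1))) / (\<epsilon> * real T))
          * vnorm N (mat_vec N (psd_sqrt N \<Sigma>) w))\<^sup>2
      - (real T - 1 - (real T - 1) * ((\<Sum>t=1..T-1. \<rho> t) / (real T - 1))) / (\<epsilon> * real T)
          * quad_form N \<Sigma> w)"
proof (cases "\<exists>i<N. w i \<noteq> 0")
  case True
  define q where "q = quad_form N \<Sigma> w"
  define l where "l = (\<Sum>k<T. \<rho> k)"
  have T: "T > 0" and N: "N > 0" using assms by auto
  have q: "q > 0" using True assms(5) by (auto simp: q_def pos_def_def)
  \<comment> \<open>Splitting off \<open>\<rho> 0 = 1\<close> turns the average correlation into the
    row sum \<open>l\<close>; \<open>T \<ge> 2\<close> allows \<open>T - 1\<close> to be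
    cancelled.\<close>
  have "{..<T} = insert 0 {1..T-1}" using T by auto
  then have "l = 1 + (\<Sum>t=1..T-1. \<rho> t)" using assms(6) by (simp add: l_def)
  then have sum_eq: "(real T - 1) * ((\<Sum>t=1..T-1. \<rho> t) / (real T - 1)) = l - 1"
    using assms(1) by simp
  have vnorm: "vnorm N (mat_vec N (psd_sqrt N \<Sigma>) w) = sqrt q"
    by (simp add: vnorm_psd_sqrt pos_def_imp_semidef assms(5) q_def)
  have sqrt1: "sqrt ((1 + (l - 1)) * \<epsilon> / ((1 - \<epsilon>) * real T)) * sqrt q = sqrt (\<epsilon> / (1 - \<epsilon>) * (q * l / T))"
    by (simp add: mult_ac flip: real_sqrt_mult)
  have sqrt2: "sqrt ((1 - \<epsilon>) * (1 + (l - 1)) / (\<epsilon> * real T)) * sqrt q = sqrt ((1 - \<epsilon>) / \<epsilon> * (q * l / T))"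
    by (simp add: mult_ac flip: real_sqrt_mult)
  have var: "(real T - 1 - (l - 1)) / (\<epsilon> * real T) * q = (q - q * l / T) / \<epsilon>"
    using T assms(3) by (simp add: field_simps)
  have "1 - dotp N w \<mu> > sqrt (\<epsilon> / (1 - \<epsilon>) * (q * l / T))"
    using assms(10) unfolding sum_eq vnorm sqrt1 .
  then have "worst_case_growth T N \<epsilon> \<mu> \<Sigma> \<rho> w =
      (1 - ((1 - dotp N w \<mu> + sqrt ((1 - \<epsilon>) / \<epsilon> * (q * l / T)))\<^sup>2 + (q - q * l / T) / \<epsilon>)) / 2"
    using worst_case_growth_eq[OF T N assms(3,4,5,8,6), of w \<mu>] q by (simp add: q_def l_def)
  then show ?thesis unfolding sum_eq vnorm sqrt2 q_def[symmetric] var by simp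
next
  case False
  then have w: "w i = 0" if "i < N" for i using that by blast
  \<comment> \<open>For the zero portfolio the claimed formula reduces to
    \<open>1/2 * (1 - 1)\<close>.\<close>
  then have "dotp N w \<mu> = 0" "quad_form N \<Sigma> w = 0" "vnorm N (mat_vec N (psd_sqrt N \<Sigma>) w) = 0"
    by (simp_all add: dotp_def quad_form_def vnorm_def mat_vec_def)
  moreover have "worst_case_growth T N \<epsilon> \<mu> \<Sigma> \<rho> w = 0"
    by (rule worst_case_growth_zero_variance) (use assms w in auto)
  ultimately show ?thesis by simp
qed

end
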